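(* Let $\Omega\subseteq\mathbb{C}$ be an open set such that $(\mathbb{C}\cup\{\infty\})\setminus\overline{\Omega}$ is connected, let $\zeta_0\in\overline{\Omega}$, and let $\mathcal{F}\subseteq\mathbb{N}\times\mathbb{N}$ contain a sequence $(\tilde p_n,\tilde q_n)$, $n=1,2,\dots$, with $\tilde p_n\to+\infty$. Then there exist a function $f\in A^\infty(\Omega)$ and a sequence $(p_n,q_n)\in\mathcal{F}$, $n=1,2,\dots$, such that for every compact set $K\subseteq\overline{\Omega}$ the following hold: $f\in\mathcal{D}_{p_n,q_n}(\zeta_0)$ for all $n=1,2,\dots$, and $\sup_{z\in K}\big|[p_n/q_n]^{(\ell)}_{f,\zeta_0}(z)-f^{(\ell)}(z)\big|\to 0$ as $n\to+\infty$, for every $\ell=0,1,2,\dots$. Moreover, the set of such functions $f\in X^\infty$ (those for which such a sequence $(p_n,q_n)$ exists) is $G_\delta$ and dense in $X^\infty$, the closure of the polynomials in $A^\infty(\Omega)$.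
   Context: $\overline{\Omega}$ is the closure of $\Omega$ in $\mathbb{C}$. $A^\infty(\Omega)$ is the set of $f$ holomorphic in $\Omega$ such that every derivative $f^{(\ell)}$, $\ell=0,1,2,\dots$, extends continuously to $\overline{\Omega}$ (the extension is still denoted $f^{(\ell)}$); it is a Fréchet space with the topology in which $f_m\to f$ iff $f_m^{(\ell)}\to f^{(\ell)}$ uniformly on each compact subset of $\overline{\Omega}$ for every $\ell$. $H(\overline{\Omega})$ is the set of functions holomorphic on some (varying) open set containing $\overline{\Omega}$, and $X^\infty$ is the closure of $H(\overline{\Omega})$ in $A^\infty(\Omega)$, with the induced topology; for $\Omega$ as in the statement it coincides with the closure of the polynomials. Padé approximants. Degrees $p,q$ range over $\mathbb{N}=\{0,1,2,\dots\}$. For $f\in A^\infty(\Omega)$ and $\zeta\in\overline{\Omega}$ put $a_v=f^{(v)}(\zeta)/v!$ (for $\zeta\in\partial\Omega$ defined by continuous extension), and consider the formal series $\sum_{v\ge0}a_v(z-\zeta)^v$. A Padé approximant $[p/q]_{f,\zeta}$ is a rational function of the form $P/Q$, $P(z)=\sum_{v=0}^p n_v(z-\zeta)^v$, $Q(z)=\sum_{v=0}^q d_v(z-\zeta)^v$ with $d_0=1$, whose Taylor coefficients $b_v$ at $\zeta$ satisfy $b_v=a_v$ for $v=0,\dots,p+q$. We write $f\in\mathcal{D}_{p,q}(\zeta)$ if the Hankel determinant $\det\big(a_{p-q+i+j-1}\big)_{i,j=1}^q$ is nonzero, with $a_i=0$ for $i<0$ (for $q=0$ the condition is always satisfied). In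 that case $[p/q]_{f,\zeta}$ exists and is unique. $[p/q]^{(\ell)}_{f,\zeta}$ denotes its $\ell$-th derivative in $z$. The value of a rational function at a pole is taken to be $\infty$, so a finite supremum over $K$ means that there are no poles in $K$. *)

theory Defs
  imports "HOL-Complex_Analysis.Complex_Analysis" "Jordan_Normal_Form.Determinant"
begin

text \<open>
  A function on \<open>\<Omega>\<close> is represented by a total function that is \<open>undefined\<close> outside \<open>\<Omega>\<close>,
  so that equality of elements of the function space is equality on \<open>\<Omega>\<close>. The continuous
  extension of the \<open>l\<close>-th derivative to the closure is recovered as a limit from within \<open>\<Omega>\<close>;
  at points of the open set \<open>\<Omega>\<close> it is the derivative itself.
\<close>

definition ext_deriv :: "complex set \<Rightarrow> nat \<Rightarrow> (complex \<Rightarrow> complex) \<Rightarrow> complex \<Rightarrow> complex" where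
  "ext_deriv \<Omega> l f z = Lim (at z within \<Omega>) ((deriv ^^ l) f)"

definition A_infty :: "complex set \<Rightarrow> (complex \<Rightarrow> complex) set" where
  "A_infty \<Omega> = {f \<in> extensional \<Omega>. f holomorphic_on \<Omega> \<and>
     (\<forall>l. \<exists>g. continuous_on (closure \<Omega>) g \<and> (\<forall>z\<in>\<Omega>. g z = (deriv ^^ l) f z))}"

definition A_infty_ball ::
  "complex set \<Rightarrow> nat \<Rightarrow> complex set \<Rightarrow> (complex \<Rightarrow> complex) \<Rightarrow> real \<Rightarrow> (complex \<Rightarrow> complex) set" where
  "A_infty_ball \<Omega> l K f e =
     {g \<in> A_infty \<Omega>. \<forall>z\<in>K. cmod (ext_deriv \<Omega> l g z - ext_deriv \<Omega> l f z) < e}"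

text \<open>
  The topology of uniform convergence of every derivative on every compact subset of the
  closure of \<open>\<Omega>\<close>; see \<open>limitin_A_infty_top\<close> below.
\<close>

definition A_infty_top :: "complex set \<Rightarrow> (complex \<Rightarrow> complex) topology" where
  "A_infty_top \<Omega> = topology_generated_by
     {A_infty_ball \<Omega> l K f e | l K f e.
        compact K \<and> K \<subseteq> closure \<Omega> \<and> f \<in> A_infty \<Omega> \<and> 0 < e}"

definition H_closure :: "complex set \<Rightarrow> (complex \<Rightarrow> complex) set" where
  "H_closure \<Omega> = {restrict h \<Omega> | h U. open U \<and> closure \<Omega> \<subseteq> U \<and> h holomorphic_on U}"

definition X_infty :: "complex set \<Rightarrow> (complex \<Rightarrow> complex) set" where
  "X_infty \<Omega> = A_infty_top \<Omega> closure_of H_closure \<Omega>"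

definition polynomials_on :: "complex set \<Rightarrow> (complex \<Rightarrow> complex) set" where
  "polynomials_on \<Omega> = {restrict (poly P) \<Omega> | P. True}"

definition taylor_coeff :: "complex set \<Rightarrow> (complex \<Rightarrow> complex) \<Rightarrow> complex \<Rightarrow> nat \<Rightarrow> complex" where
  "taylor_coeff \<Omega> f \<zeta> v = ext_deriv \<Omega> v f \<zeta> / fact v"

text \<open>
  Rows and columns of a matrix are numbered from 0, so the entry \<open>a\<^bsub>p-q+i+j-1\<^esub>\<close> with
  \<open>i, j \<in> {1..q}\<close> has index \<open>p - q + i + j + 1\<close> for \<open>i, j \<in> {0..<q}\<close>.
  The determinant of the \<open>0 \<times> 0\<close> matrix is 1.
\<close>

definition hankel_det :: "(nat \<Rightarrow> complex) \<Rightarrow> nat \<Rightarrow> nat \<Rightarrow> complex" where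
  "hankel_det a p q = Determinant.det (Matrix.mat q q (\<lambda>(i, j).
     let k = int p - int q + int i + int j + 1 in if k < 0 then 0 else a (nat k)))"

definition D_class :: "complex set \<Rightarrow> complex \<Rightarrow> nat \<Rightarrow> nat \<Rightarrow> (complex \<Rightarrow> complex) set" where
  "D_class \<Omega> \<zeta> p q = {f \<in> A_infty \<Omega>. hankel_det (taylor_coeff \<Omega> f \<zeta>) p q \<noteq> 0}"

text \<open>
  A rational function regular at \<open>\<zeta>\<close> is represented by the pair of its numerator and its
  denominator in lowest terms, both in powers of \<open>z - \<zeta>\<close>, the denominator having constant
  coefficient 1. This representation is unique, and the poles are exactly the zeros of the
  denominator. Cancelling common factors affects neither the degree bounds nor the
  normalisation.
\<close>

definition ratfun :: "complex \<Rightarrow> complex poly \<times> complex poly \<Rightarrow> complex \<Rightarrow> complex" where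
  "ratfun \<zeta> R z = poly (fst R) (z - \<zeta>) / poly (snd R) (z - \<zeta>)"

definition is_pade ::
  "(nat \<Rightarrow> complex) \<Rightarrow> complex \<Rightarrow> nat \<Rightarrow> nat \<Rightarrow> complex poly \<times> complex poly \<Rightarrow> bool" where
  "is_pade a \<zeta> p q R \<longleftrightarrow>
     degree (fst R) \<le> p \<and> degree (snd R) \<le> q \<and> coeff (snd R) 0 = 1 \<and>
     coprime (fst R) (snd R) \<and>
     (\<forall>v\<le>p + q. (deriv ^^ v) (ratfun \<zeta> R) \<zeta> / fact v = a v)"

definition pade ::
  "complex set \<Rightarrow> (complex \<Rightarrow> complex) \<Rightarrow> complex \<Rightarrow> nat \<Rightarrow> nat \<Rightarrow> complex poly \<times> complex poly" where
  "pade \<Omega> f \<zeta> p q = (THE R. is_pade (taylor_coeff \<Omega> f \<zeta>) \<zeta> p q R)"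

text \<open>
  The value of \<open>|[p/q]\<^sup>(\<^sup>l\<^sup>)(z) - f\<^sup>(\<^sup>l\<^sup>)(z)|\<close>, which is \<open>\<infinity>\<close> when \<open>z\<close> is a pole.
\<close>

definition pade_error ::
  "complex set \<Rightarrow> (complex \<Rightarrow> complex) \<Rightarrow> complex \<Rightarrow> nat \<Rightarrow> nat \<Rightarrow> nat \<Rightarrow> complex \<Rightarrow> ennreal" where
  "pade_error \<Omega> f \<zeta> p q l z =
     (let R = pade \<Omega> f \<zeta> p q in
      if poly (snd R) (z - \<zeta>) = 0 then \<infinity>
      else ennreal (cmod ((deriv ^^ l) (ratfun \<zeta> R) z - ext_deriv \<Omega> l f z)))"

definition pade_approximable ::
  "complex set \<Rightarrow> complex \<Rightarrow> (nat \<times> nat) set \<Rightarrow> (complex \<Rightarrow> complex) \<Rightarrow> bool" where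
  "pade_approximable \<Omega> \<zeta> \<F> f \<longleftrightarrow>
     (\<exists>p q :: nat \<Rightarrow> nat. (\<forall>n. (p n, q n) \<in> \<F>) \<and>
        (\<forall>K. compact K \<and> K \<subseteq> closure \<Omega> \<longrightarrow>
           (\<forall>n. f \<in> D_class \<Omega> \<zeta> (p n) (q n)) \<and>
           (\<forall>l. (\<lambda>n. SUP z\<in>K. pade_error \<Omega> f \<zeta> (p n) (q n) l z) \<longlonglongrightarrow> 0)))"

lemma ext_deriv_eqI:
  assumes "continuous_on (closure \<Omega>) g" "\<And>z. z \<in> \<Omega> \<Longrightarrow> g z = (deriv ^^ l) f z"
    and "open \<Omega>" "z \<in> closure \<Omega>"
  shows "ext_deriv \<Omega> l f z = g z"
proof -
  have "z islimpt \<Omega>"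
  proof (cases "z \<in> \<Omega>")
    case True
    then show ?thesis using interior_limit_point[of z \<Omega>] assms(3) by (simp add: interior_open)
  next
    case False
    then show ?thesis using assms(4) unfolding closure_def by blast
  qed
  then have nt: "at z within \<Omega> \<noteq> bot"
    using trivial_limit_within by blast
  have "(g \<longlongrightarrow> g z) (at z within closure \<Omega>)"
    using assms(1,4) by (simp add: continuous_on_def)
  then have "(g \<longlongrightarrow> g z) (at z within \<Omega>)"
    by (rule tendsto_within_subset[OF _ closure_subset])
  then have "((deriv ^^ l) f \<longlongrightarrow> g z) (at z within \<Omega>)"
    by (rule Lim_transform_eventually) (simp add: eventually_at_filter assms(2))
  then show ?thesis
    unfolding ext_deriv_def by (rule tendsto_Lim[OF nt])
qed

lemma continuous_on_ext_deriv:
  assumes "open \<Omega>" "f \<in> A_infty \<Omega>"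
  shows "continuous_on (closure \<Omega>) (ext_deriv \<Omega> l f)"
proof -
  have "\<exists>g. continuous_on (closure \<Omega>) g \<and> (\<forall>z\<in>\<Omega>. g z = (deriv ^^ l) f z)"
    using assms(2) by (simp add: A_infty_def)
  then obtain g where g: "continuous_on (closure \<Omega>) g \<and> (\<forall>z\<in>\<Omega>. g z = (deriv ^^ l) f z)"
    by (rule exE)
  have "g z = ext_deriv \<Omega> l f z" if "z \<in> closure \<Omega>" for z
    using ext_deriv_eqI[of \<Omega> g l f z] g assms(1) that by simp
  then show ?thesis
    using continuous_on_eq[of "closure \<Omega>" g "ext_deriv \<Omega> l f"] g by simp
qed

lemma ext_deriv_interior:
  assumes "open \<Omega>" "f \<in> A_infty \<Omega>" "z \<in> \<Omega>"
  shows "ext_deriv \<Omega> l f z = (deriv ^^ l) f z"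
proof -
  have "\<exists>g. continuous_on (closure \<Omega>) g \<and> (\<forall>z\<in>\<Omega>. g z = (deriv ^^ l) f z)"
    using assms(2) by (simp add: A_infty_def)
  then obtain g where g: "continuous_on (closure \<Omega>) g \<and> (\<forall>z\<in>\<Omega>. g z = (deriv ^^ l) f z)"
    by (rule exE)
  have "z \<in> closure \<Omega>"
    using assms(3) closure_subset by (rule rev_subsetD)
  then show ?thesis
    using ext_deriv_eqI[of \<Omega> g l f z] g assms(1,3) by simp
qed

lemma topspace_A_infty_top: "topspace (A_infty_top \<Omega>) = A_infty \<Omega>"
proof -
  have "f \<in> topspace (A_infty_top \<Omega>)" if "f \<in> A_infty \<Omega>" for f
    unfolding A_infty_top_def topology_generated_by_topspace
    by (rule UnionI[of "A_infty_ball \<Omega> 0 {} f 1"], rule CollectI,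
        rule exI[of _ 0], rule exI[of _ "{}"], rule exI[of _ f], rule exI[of _ 1])
      (use that in \<open>simp_all add: A_infty_ball_def\<close>)
  moreover have "topspace (A_infty_top \<Omega>) \<subseteq> A_infty \<Omega>"
    unfolding A_infty_top_def topology_generated_by_topspace
    by (auto simp: A_infty_ball_def)
  ultimately show ?thesis by blast
qed

lemma limitin_A_infty_top:
  assumes "open \<Omega>" and F: "\<And>m. F m \<in> A_infty \<Omega>" and f: "f \<in> A_infty \<Omega>"
  shows "limitin (A_infty_top \<Omega>) F f sequentially \<longleftrightarrow>
    (\<forall>l K. compact K \<and> K \<subseteq> closure \<Omega> \<longrightarrow>
       uniform_limit K (\<lambda>m. ext_deriv \<Omega> l (F m)) (ext_deriv \<Omega> l f) sequentially)"
    (is "?L \<longleftrightarrow> ?R")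
proof
  assume L: ?L
  show ?R
  proof (intro allI impI)
    fix l K assume K: "compact K \<and> K \<subseteq> closure \<Omega>"
    show "uniform_limit K (\<lambda>m. ext_deriv \<Omega> l (F m)) (ext_deriv \<Omega> l f) sequentially"
    proof (rule uniform_limitI)
      fix e :: real assume e: "0 < e"
      have "openin (A_infty_top \<Omega>) (A_infty_ball \<Omega> l K f e)"
        unfolding A_infty_top_def using K e f
        by (intro topology_generated_by_Basis CollectI exI[of _ l] exI[of _ K] exI[of _ f] exI[of _ e])
          simp
      moreover have "f \<in> A_infty_ball \<Omega> l K f e"
        using f e by (simp add: A_infty_ball_def)
      ultimately have "\<forall>\<^sub>F m in sequentially. F m \<in> A_infty_ball \<Omega> l K f e"
        using L by (simp add: limitin_def)
      then show "\<forall>\<^sub>F m in sequentially. \<forall>z\<in>K. dist (ext_deriv \<Omega> l (F m) z) (ext_deriv \<Omega> l f z) < e"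
        by eventually_elim (simp add: A_infty_ball_def dist_norm)
    qed
  qed
next
  assume R: ?R
  have "f \<in> U \<longrightarrow> (\<forall>\<^sub>F m in sequentially. F m \<in> U)"
    if "generate_topology_on {A_infty_ball \<Omega> l K h e | l K h e.
        compact K \<and> K \<subseteq> closure \<Omega> \<and> h \<in> A_infty \<Omega> \<and> 0 < e} U" for U
    using that
  proof (induction rule: generate_topology_on.induct)
    case Empty
    then show ?case by simp
  next
    case (Int a b)
    then show ?case by (auto intro: eventually_conj)
  next
    case (UN K)
    show ?case
    proof
      assume "f \<in> \<Union>K"
      then obtain k where k: "k \<in> K" "f \<in> k" by blast
      then have "\<forall>\<^sub>F m in sequentially. F m \<in> k" using UN by blast
      then show "\<forall>\<^sub>F m in sequentially. F m \<in> \<Union>K"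
        by (rule eventually_mono) (use k(1) in blast)
    qed
  next
    case (Basis s)
    then obtain l K h e where s: "s = A_infty_ball \<Omega> l K h e"
      and K: "compact K" "K \<subseteq> closure \<Omega>" and h: "h \<in> A_infty \<Omega>" by blast
    show ?case
    proof
      assume "f \<in> s"
      then have lt: "\<forall>z\<in>K. cmod (ext_deriv \<Omega> l f z - ext_deriv \<Omega> l h z) < e"
        by (simp add: s A_infty_ball_def)
      have "continuous_on K (\<lambda>z. cmod (ext_deriv \<Omega> l f z - ext_deriv \<Omega> l h z))"
        by (intro continuous_intros
            continuous_on_subset[OF continuous_on_ext_deriv[OF assms(1)] K(2)] f h)
      then obtain d where d: "0 < d" "\<forall>z\<in>K. cmod (ext_deriv \<Omega> l f z - ext_deriv \<Omega> l h z) \<le> e - d"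
      proof (cases "K = {}")
        case True
        then show ?thesis using that[of 1] by simp
      next
        case False
        assume c: "continuous_on K (\<lambda>z. cmod (ext_deriv \<Omega> l f z - ext_deriv \<Omega> l h z))"
        obtain w where "w \<in> K" and w: "\<forall>z\<in>K. cmod (ext_deriv \<Omega> l f z - ext_deriv \<Omega> l h z)
            \<le> cmod (ext_deriv \<Omega> l f w - ext_deriv \<Omega> l h w)"
          using continuous_attains_sup[OF K(1) False c] by blast
        then show ?thesis
          using lt that[of "e - cmod (ext_deriv \<Omega> l f w - ext_deriv \<Omega> l h w)"] by simp
      qed
      have "\<forall>\<^sub>F m in sequentially. \<forall>z\<in>K. dist (ext_deriv \<Omega> l (F m) z) (ext_deriv \<Omega> l f z) < d"
        using R[rule_format, OF conjI[OF K]] d(1) by (rule uniform_limitD)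
      then show "\<forall>\<^sub>F m in sequentially. F m \<in> s"
      proof eventually_elim
        case (elim m)
        have "cmod (ext_deriv \<Omega> l (F m) z - ext_deriv \<Omega> l h z) < e" if "z \<in> K" for z
          using elim[rule_format, OF that] d(2)[rule_format, OF that]
            norm_triangle_ineq[of "ext_deriv \<Omega> l (F m) z - ext_deriv \<Omega> l f z"
              "ext_deriv \<Omega> l f z - ext_deriv \<Omega> l h z"]
          by (simp add: dist_norm)
        then show ?case using F by (simp add: s A_infty_ball_def)
      qed
    qed
  qed
  moreover have "f \<in> topspace (A_infty_top \<Omega>)"
    using f by (simp add: topspace_A_infty_top)
  ultimately show ?L
    unfolding limitin_def A_infty_top_def openin_topology_generated_by_iff by simp
qed

end

theory Submission
  imports Defs
begin

text \<open>
  If the Hankel determinant is nonzero, the coefficients of the Pade approximant are rational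
  functions of finitely many Taylor coefficients, so for fixed \<open>(p, q)\<close> and \<open>j\<close> the functions whose
  approximant \<open>[p/q]\<close> is within \<open>1/(j + 1)\<close> on \<open>closure \<Omega> \<inter> cball 0 j\<close>, together with its first \<open>j\<close>
  derivatives, form an open set. The functions in the theorem are those which, for every \<open>j\<close>, lie in
  one of these sets with \<open>(p, q) \<in> \<F>\<close>; hence the \<open>G\<^sub>\<delta>\<close> property. For density, a polynomial of degree
  exactly \<open>p\<close> has nonzero Hankel determinant for every \<open>q\<close> and is its own \<open>[p/q]\<close> approximant.
  Polynomials are dense in \<open>X_infty \<Omega>\<close> by Runge's theorem, because \<open>closure \<Omega> \<inter> cball 0 m\<close> has
  connected complement.
\<close>

section \<open>Uniform approximation by polynomials and Runge's theorem\<close>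

text \<open>Convergence in \<open>A_infty_top\<close> controls every derivative up to the boundary
  of \<open>\<Omega>\<close>, while Cauchy's estimate bounds derivatives only at a positive distance
  inside the set where the function is bounded. Runge's theorem is therefore needed on a
  neighbourhood \<open>\<Union>x\<in>L. cball x r\<close> of the compact set \<open>L\<close>. Such
  a neighbourhood may have a disconnected complement although \<open>- L\<close> is connected, so
  poles are moved through \<open>- L\<close> itself and \<open>r\<close> shrinks on the way.

  The degree has to be exactly \<open>p\<close>: for a polynomial of degree at most \<open>p\<close>
  the Hankel matrix has the coefficient of order \<open>p\<close> on its antidiagonal and zeros
  below it, so its determinant is a power of that coefficient up to sign. Since \<open>p'\<close>
  tends to infinity, every polynomial can be perturbed by a small term of a higher admissible
  degree.

  \<open>A_infty_top\<close> is given by a subbase and not by a metric. The nested balls of the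
  density argument are taken among entire functions, where sup norms on discs suffice and the
  centres converge to an entire function.\<close>

definition poly_approx :: "complex set \<Rightarrow> (complex \<Rightarrow> complex) \<Rightarrow> bool" where
  "poly_approx A f \<longleftrightarrow> (\<forall>e>0. \<exists>p. \<forall>z\<in>A. cmod (f z - poly p z) < e)"

lemma poly_approx_poly [simp]: "poly_approx A (poly p)"
  unfolding poly_approx_def by (metis cancel_comm_monoid_add_class.diff_cancel norm_zero)

lemma poly_approx_const [simp]: "poly_approx A (\<lambda>z. c)"
  unfolding poly_approx_def by (intro allI impI exI[of _ "[:c:]"]) simp

lemma poly_approx_subset: "poly_approx A f \<Longrightarrow> B \<subseteq> A \<Longrightarrow> poly_approx B f"
  unfolding poly_approx_def by (meson subset_iff)

lemma poly_approx_cong: "(\<And>z. z \<in> A \<Longrightarrow> f z = g z) \<Longrightarrow> poly_approx A f \<longleftrightarrow> poly_approx A g"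
  unfolding poly_approx_def by simp

lemma poly_approx_limit:
  assumes "\<And>e. e > 0 \<Longrightarrow> \<exists>g. poly_approx A g \<and> (\<forall>z\<in>A. cmod (f z - g z) < e)"
  shows "poly_approx A f"
  unfolding poly_approx_def
proof (intro allI impI)
  fix e :: real assume "e > 0"
  then obtain g where g: "poly_approx A g" "\<forall>z\<in>A. cmod (f z - g z) < e/2"
    using assms[of "e/2"] by auto
  then obtain p where p: "\<forall>z\<in>A. cmod (g z - poly p z) < e/2"
    using \<open>e > 0\<close> unfolding poly_approx_def by (meson half_gt_zero)
  have "cmod (f z - poly p z) < e" if "z \<in> A" for z
    using g(2) p that norm_triangle_ineq[of "f z - g z" "g z - poly p z"] by force
  then show "\<exists>p. \<forall>z\<in>A. cmod (f z - poly p z) < e" by blast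
qed

lemma poly_approx_add:
  assumes "poly_approx A f" "poly_approx A g"
  shows "poly_approx A (\<lambda>z. f z + g z)"
  unfolding poly_approx_def
proof (intro allI impI)
  fix e :: real assume "e > 0"
  then obtain p q where p: "\<forall>z\<in>A. cmod (f z - poly p z) < e/2" and q: "\<forall>z\<in>A. cmod (g z - poly q z) < e/2"
    using assms unfolding poly_approx_def by (meson half_gt_zero)
  have "cmod (f z + g z - poly (p + q) z) < e" if "z \<in> A" for z
  proof -
    have "cmod ((f z - poly p z) + (g z - poly q z)) < e / 2 + e / 2"
      using p q that by (intro norm_add_less) auto
    then show ?thesis by (simp add: algebra_simps)
  qed
  then show "\<exists>p. \<forall>z\<in>A. cmod (f z + g z - poly p z) < e" by blast
qed

lemma poly_approx_mult:
  assumes "poly_approx A f" "poly_approx A g"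
    and f: "\<And>z. z \<in> A \<Longrightarrow> cmod (f z) \<le> B" and g: "\<And>z. z \<in> A \<Longrightarrow> cmod (g z) \<le> B"
  shows "poly_approx A (\<lambda>z. f z * g z)"
  unfolding poly_approx_def
proof (intro allI impI)
  fix e :: real assume "e > 0"
  \<comment> \<open>The cap \<open>1\<close> gives
    \<open>cmod (poly q z) \<le> \<bar>B\<bar> + 1\<close>, so the total error is below
    \<open>(2 * \<bar>B\<bar> + 1) * d\<close>, hence below \<open>e\<close>. The absolute value
    covers a negative \<open>B\<close>, possible when \<open>A\<close> is empty.\<close>
  define d where "d = min 1 (e / (2 * (\<bar>B\<bar> + 1)))"
  have d: "d > 0" "d \<le> 1" "d \<le> e / (2 * (\<bar>B\<bar> + 1))"
    using \<open>e > 0\<close> by (auto simp: d_def add_nonneg_pos)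
  have d3: "d * (2 * (\<bar>B\<bar> + 1)) \<le> e"
    using d(3) by (subst (asm) pos_le_divide_eq) (auto simp: add_nonneg_pos)
  obtain p q where p: "\<forall>z\<in>A. cmod (f z - poly p z) < d" and q: "\<forall>z\<in>A. cmod (g z - poly q z) < d"
    using assms(1,2) d(1) unfolding poly_approx_def by meson
  have "cmod (f z * g z - poly (p * q) z) < e" if z: "z \<in> A" for z
  proof -
    have "cmod (poly q z) \<le> cmod (g z) + cmod (g z - poly q z)"
      by (metis norm_minus_commute norm_triangle_sub)
    then have q': "cmod (poly q z) \<le> \<bar>B\<bar> + 1"
      using g[OF z] q z d(2) by force
    have "f z * g z - poly (p * q) z = f z * (g z - poly q z) + poly q z * (f z - poly p z)"
      by (simp add: algebra_simps)
    also have "cmod \<dots> \<le> cmod (f z) * cmod (g z - poly q z) + cmod (poly q z) * cmod (f z - poly p z)"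
      by (metis norm_mult norm_triangle_ineq)
    also have "\<dots> \<le> \<bar>B\<bar> * d + (\<bar>B\<bar> + 1) * cmod (f z - poly p z)"
      using f[OF z] q q' z by (intro add_mono mult_mono) (auto intro: less_imp_le)
    also have "\<dots> < \<bar>B\<bar> * d + (\<bar>B\<bar> + 1) * d"
      using p z by (intro add_strict_left_mono mult_strict_left_mono) auto
    also have "\<dots> \<le> e" using d(1) d3 by (simp add: algebra_simps)
    finally show ?thesis .
  qed
  then show "\<exists>p. \<forall>z\<in>A. cmod (f z * g z - poly p z) < e" by blast
qed

lemma poly_approx_cmult:
  assumes "poly_approx A f"
  shows "poly_approx A (\<lambda>z. c * f z)"
  unfolding poly_approx_def
proof (intro allI impI)
  fix e :: real assume "e > 0"
  then have "e / (cmod c + 1) > 0" by (simp add: add_nonneg_pos)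
  then obtain p where p: "\<forall>z\<in>A. cmod (f z - poly p z) < e / (cmod c + 1)"
    using assms unfolding poly_approx_def by blast
  have "cmod (c * f z - poly (Polynomial.smult c p) z) < e" if "z \<in> A" for z
  proof -
    have "cmod (c * f z - poly (Polynomial.smult c p) z) = cmod c * cmod (f z - poly p z)"
      by (simp add: norm_mult[symmetric] right_diff_distrib)
    also have "\<dots> \<le> (cmod c + 1) * cmod (f z - poly p z)"
      by (intro mult_right_mono) auto
    also have "\<dots> < (cmod c + 1) * (e / (cmod c + 1))"
      using p that by (intro mult_strict_left_mono) (auto simp: add_nonneg_pos)
    also have "\<dots> = e"
      using norm_ge_zero[of c] by (simp add: add_nonneg_eq_0_iff)
    finally show ?thesis .
  qed
  then show "\<exists>p. \<forall>z\<in>A. cmod (c * f z - poly p z) < e" by blast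
qed

lemma poly_approx_sum:
  "(\<And>i. i \<in> I \<Longrightarrow> poly_approx A (f i)) \<Longrightarrow> poly_approx A (\<lambda>z. \<Sum>i\<in>I. f i z)"
  by (induction I rule: infinite_finite_induct) (auto intro: poly_approx_add)

text \<open>Partial sums of the geometric series are polynomials in \<open>u\<close>. Powers of
  \<open>u\<close> stay approximable because \<open>u\<close> is bounded by 1, and the remainder
  \<open>u z ^ N / (1 - u z)\<close> is at most \<open>c ^ N / (1 - c)\<close>, uniformly on
  \<open>A\<close>.\<close>

lemma poly_approx_geometric:
  assumes u: "poly_approx A u" and c: "\<And>z. z \<in> A \<Longrightarrow> cmod (u z) \<le> c" "0 \<le> c" "c < 1"
  shows "poly_approx A (\<lambda>z. 1 / (1 - u z))"
proof (rule poly_approx_limit)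
  fix e :: real assume "e > 0"
  have pow: "poly_approx A (\<lambda>z. u z ^ n)" for n
  proof (induction n)
    case (Suc n)
    have "cmod (u z) \<le> 1" if "z \<in> A" for z
      using c(1)[OF that] c(3) by simp
    moreover from this have "cmod (u z ^ n) \<le> 1" if "z \<in> A" for z
      using that by (simp add: norm_power power_le_one)
    ultimately show ?case
      using poly_approx_mult[OF u Suc.IH, of 1] by simp
  qed simp
  have "(\<lambda>n. c ^ n / (1 - c)) \<longlonglongrightarrow> 0 / (1 - c)"
    using c by (intro tendsto_intros LIMSEQ_power_zero) auto
  then have "\<forall>\<^sub>F n in sequentially. c ^ n / (1 - c) < e"
    using \<open>e > 0\<close> by (auto dest: order_tendstoD)
  then obtain N where N: "c ^ N / (1 - c) < e"
    by (auto simp: eventually_sequentially)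
  have "cmod (1 / (1 - u z) - (\<Sum>n<N. u z ^ n)) < e" if z: "z \<in> A" for z
  proof -
    have uc: "cmod (u z) \<le> c" using c z by blast
    then have 1: "1 - c \<le> cmod (1 - u z)"
      using norm_triangle_ineq2[of 1 "u z"] by simp
    then have ne: "u z \<noteq> 1" using c(3) by auto
    then have "1 / (1 - u z) - (\<Sum>n<N. u z ^ n) = u z ^ N / (1 - u z)"
      by (simp add: sum_gp_strict field_simps)
    then have "cmod (1 / (1 - u z) - (\<Sum>n<N. u z ^ n)) = cmod (u z) ^ N / cmod (1 - u z)"
      by (simp add: norm_divide norm_power)
    also have "\<dots> \<le> c ^ N / (1 - c)"
      using 1 c uc by (intro frac_le power_mono) auto
    finally show ?thesis using N by simp
  qed
  moreover have "poly_approx A (\<lambda>z. \<Sum>n<N. u z ^ n)"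
    by (intro poly_approx_sum pow)
  ultimately show "\<exists>g. poly_approx A g \<and> (\<forall>z\<in>A. cmod (1 / (1 - u z) - g z) < e)" by blast
qed

text \<open>One step of pole pushing: \<open>w' - z = (w - z) * (1 - (w - w') / (w - z))\<close>,
  and the quotient has modulus at most 1/2 when the pole moves by at most half its distance from
  \<open>A\<close>. The geometric series in this quotient then applies.\<close>

lemma poly_approx_move_pole:
  assumes w: "poly_approx A (\<lambda>z. 1 / (w - z))" and d: "d > 0" "\<And>z. z \<in> A \<Longrightarrow> d \<le> cmod (w - z)"
    and w': "cmod (w' - w) \<le> d / 2"
  shows "poly_approx A (\<lambda>z. 1 / (w' - z))"
proof -
  have b: "cmod (1 / (w - z)) \<le> 1 / d" if "z \<in> A" for z
    using frac_le[of 1 1 d "cmod (w - z)"] d(2)[OF that] d(1) by (simp add: norm_divide)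
  have b2: "cmod ((w - w') * (1 / (w - z))) \<le> 1 / 2" if "z \<in> A" for z
  proof -
    have "cmod (w - w') * cmod (1 / (w - z)) \<le> (d / 2) * (1 / d)"
      using b[OF that] w' d(1) by (intro mult_mono) (auto simp: norm_minus_commute)
    then show ?thesis using d(1) by (simp only: norm_mult) simp
  qed
  have "poly_approx A (\<lambda>z. 1 / (w - z) * (1 / (1 - (w - w') * (1 / (w - z)))))"
  proof (rule poly_approx_mult[OF w poly_approx_geometric, where B = "max (1 / d) 2"])
    show "poly_approx A (\<lambda>z. (w - w') * (1 / (w - z)))" by (rule poly_approx_cmult[OF w])
    show "cmod ((w - w') * (1 / (w - z))) \<le> 1 / 2" if "z \<in> A" for z using b2[OF that] .
    show "cmod (1 / (w - z)) \<le> max (1 / d) 2" if "z \<in> A" for z using b[OF that] by simp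
    show "cmod (1 / (1 - (w - w') * (1 / (w - z)))) \<le> max (1 / d) 2" if "z \<in> A" for z
    proof -
      have "1 / 2 \<le> cmod (1 - (w - w') * (1 / (w - z)))"
        using norm_triangle_ineq2[of 1 "(w - w') * (1 / (w - z))"] b2[OF that] by simp
      then have "1 / cmod (1 - (w - w') * (1 / (w - z))) \<le> 1 / (1 / 2)"
        by (intro divide_left_mono) auto
      then show ?thesis by (simp only: norm_divide) simp
    qed
  qed auto
  moreover have "1 / (w - z) * (1 / (1 - (w - w') * (1 / (w - z)))) = 1 / (w' - z)" if "z \<in> A" for z
  proof -
    have "w \<noteq> z" using d that by force
    then have "(w - z) * (1 - (w - w') * (1 / (w - z))) = w' - z" by (simp add: field_simps)
    then show ?thesis by (metis (no_types) divide_divide_eq_left' mult.right_neutral times_divide_eq_right mult.commute)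
  qed
  ultimately show ?thesis by (simp cong: poly_approx_cong)
qed

text \<open>For a pole far away the kernel is a geometric series in \<open>z\<close>; connectedness
  of \<open>- L\<close> carries approximability from there to \<open>w\<close>. No single
  neighbourhood of \<open>L\<close> serves all poles, so the property that is carried along is the
  existence of some radius. One radius for all poles near \<open>w\<close> is obtained at the end,
  for a later compactness argument.\<close>

lemma poly_approx_inverse_local:
  assumes L: "compact L" "connected (- L)" and w: "w \<notin> L"
  shows "\<exists>d>0. \<exists>r>0. \<forall>w'\<in>ball w d. poly_approx (\<Union>x\<in>L. cball x r) (\<lambda>z. 1 / (w' - z))"
proof -
  define P where "P r v \<longleftrightarrow> poly_approx (\<Union>x\<in>L. cball x r) (\<lambda>z. 1 / (v - z))" for r v
  \<comment> \<open>Within a ball around \<open>w\<close> the property passes between any two poles,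
    in both directions, at the price of cutting the radius to \<open>d\<close>. This is the local
    constancy that induction along a connected set requires.\<close>
  have loc: "\<exists>d>0. ball w d \<subseteq> - L \<and> (\<forall>w1\<in>ball w d. \<forall>w2\<in>ball w d. \<forall>r. P r w1 \<longrightarrow> P (min r d) w2)"
    if "w \<notin> L" for w
  proof -
    have "open (- L)" using L(1) by (simp add: compact_imp_closed open_Compl)
    then obtain e where e: "e > 0" "ball w e \<subseteq> - L"
      using \<open>w \<notin> L\<close> by (meson ComplI open_contains_ball)
    \<comment> \<open>\<open>L\<close> is at distance at least \<open>8 * d\<close> from
      \<open>w\<close>. A pole within \<open>d\<close> of \<open>w\<close> and a point within
      \<open>d\<close> of \<open>L\<close> are thus more than \<open>4 * d\<close> apart, while two
      such poles differ by less than \<open>2 * d\<close>, half of that.\<close>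
    define d where "d = e / 8"
    have d: "d > 0" using e by (simp add: d_def)
    have "P (min r d) w2" if w12: "w1 \<in> ball w d" "w2 \<in> ball w d" and "P r w1" for w1 w2 r
      unfolding P_def
    proof (rule poly_approx_move_pole)
      show "poly_approx (\<Union>x\<in>L. cball x (min r d)) (\<lambda>z. 1 / (w1 - z))"
        using \<open>P r w1\<close> unfolding P_def by (rule poly_approx_subset) force
      show "4 * d > 0" using d by simp
      show "cmod (w2 - w1) \<le> (4 * d) / 2"
        using w12 dist_triangle[of w2 w1 w] by (simp add: dist_norm norm_minus_commute)
      fix z assume "z \<in> (\<Union>x\<in>L. cball x (min r d))"
      then obtain x where x: "x \<in> L" "dist x z \<le> d" by auto
      then have "e \<le> dist w x" using e(2) by (meson ComplD linorder_not_le mem_ball subset_eq)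
      then have "8 * d \<le> dist w x" by (simp add: d_def)
      moreover have "dist w x \<le> dist w w1 + dist w1 z + dist x z"
        by (metis add.commute add_le_cancel_left dist_commute dist_triangle dist_triangle_le group_cancel.add2)
      ultimately show "4 * d \<le> cmod (w1 - z)"
        using x(2) w12(1) d by (simp add: dist_norm)
    qed
    moreover have "ball w d \<subseteq> - L" using e d by (force simp: d_def)
    ultimately show ?thesis using d by blast
  qed
  obtain R where R: "R > 0" "\<And>x. x \<in> L \<Longrightarrow> cmod x \<le> R"
    using L(1) compact_imp_bounded bounded_pos by metis
  \<comment> \<open>Points within 1 of \<open>L\<close> have modulus at most \<open>R + 1\<close>,
    half of the modulus of \<open>w0\<close>, so the geometric series has ratio at most 1/2.\<close>
  define w0 :: complex where "w0 = of_real (2 * R + 2)"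
  have nw0: "cmod w0 = 2 * R + 2" using R(1) unfolding w0_def norm_of_real by simp
  have "\<exists>r>0. P r w0"
  proof -
    have "poly_approx (\<Union>x\<in>L. cball x 1) (\<lambda>z. 1 / w0 * (1 / (1 - poly [:0, 1 / w0:] z)))"
    proof (intro poly_approx_cmult poly_approx_geometric[where c = "1/2"] poly_approx_poly)
      fix z assume "z \<in> (\<Union>x\<in>L. cball x 1)"
      then obtain x where x: "x \<in> L" "dist x z \<le> 1" by auto
      have "cmod z \<le> cmod x + dist x z" by (metis dist_norm norm_minus_commute norm_triangle_sub)
      then have "cmod z \<le> R + 1" using R(2)[OF x(1)] x(2) by simp
      then show "cmod (poly [:0, 1 / w0:] z) \<le> 1 / 2"
        using nw0 R(1) by (simp add: norm_divide field_simps)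
    qed auto
    moreover have "1 / w0 * (1 / (1 - poly [:0, 1 / w0:] z)) = 1 / (w0 - z)" for z
      using nw0 R(1) by (cases "w0 = z") (auto simp: field_simps)
    ultimately show ?thesis unfolding P_def by (intro exI[of _ 1]) simp
  qed
  moreover have w0: "w0 \<notin> L" using R nw0 by force
  ultimately have "\<exists>r>0. P r w"
  proof (intro connected_induction_simple[OF L(2), of w0 w "\<lambda>w. \<exists>r>0. P r w"])
    fix v assume "v \<in> - L"
    then obtain d where d: "d > 0" "ball v d \<subseteq> - L"
      "\<forall>w1\<in>ball v d. \<forall>w2\<in>ball v d. \<forall>r. P r w1 \<longrightarrow> P (min r d) w2" using loc by (metis ComplD)
    have "openin (top_of_set (- L)) (ball v d)" using d(2) by (simp add: open_subset)
    moreover have "\<forall>x\<in>ball v d. \<forall>y\<in>ball v d. (\<exists>r>0. P r x) \<longrightarrow> (\<exists>r>0. P r y)"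
      using d(1,3) by (metis min_less_iff_conj)
    ultimately show "\<exists>T. openin (top_of_set (- L)) T \<and> v \<in> T \<and>
        (\<forall>x\<in>T. \<forall>y\<in>T. (\<exists>r>0. P r x) \<longrightarrow> (\<exists>r>0. P r y))"
      using d(1) by (intro exI[of _ "ball v d"]) auto
  qed (use w in auto)
  then obtain r where r: "r > 0" "P r w" by blast
  obtain d where d: "d > 0" "\<forall>w1\<in>ball w d. \<forall>w2\<in>ball w d. \<forall>r. P r w1 \<longrightarrow> P (min r d) w2"
    using loc[OF w] by blast
  then have "\<forall>w'\<in>ball w d. P (min r d) w'" using r(2) by (metis centre_in_ball)
  moreover have "min r d > 0" using d(1) r(1) by simp
  ultimately show ?thesis using d(1) unfolding P_def by blast
qed

section \<open>Cauchy integrals over segments and over the edges of a square grid\<close>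

lemma contour_integral_linepath_eq_integral:
  "contour_integral (linepath a b) f = integral {0..1} (\<lambda>t. f (linepath a b t) * (b - a))"
  unfolding contour_integral_integral by (simp cong: integral_cong)

lemma continuous_on_Cauchy_kernel:
  fixes a b :: complex
  assumes h: "continuous_on (closed_segment a b) h" and A: "A \<inter> closed_segment a b = {}"
  shows "continuous_on (A \<times> {0..1}) (\<lambda>(z, t). h (linepath a b t) / (linepath a b t - z) * (b - a))"
proof -
  have seg: "linepath a b t \<in> closed_segment a b" if "t \<in> {0..1}" for t
    using that linepath_in_path by blast
  have l: "continuous_on (A \<times> {0..1}) (\<lambda>x. linepath a b (snd x))"
    unfolding linepath_def by (intro continuous_intros)
  have c: "continuous_on (A \<times> {0..1}) (\<lambda>x. h (linepath a b (snd x)))"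
    by (rule continuous_on_compose2[OF h l]) (use seg in auto)
  have ne: "linepath a b (snd x) - fst x \<noteq> 0" if "x \<in> A \<times> {0..1}" for x
    using seg[of "snd x"] A that by auto
  have d: "continuous_on (A \<times> {0..1}) (\<lambda>x. linepath a b (snd x) - fst x)"
    by (intro continuous_on_diff l continuous_on_fst continuous_on_id)
  show ?thesis
    unfolding split_beta
    by (rule continuous_on_mult[OF continuous_on_divide[OF c d] continuous_on_const]) (use ne in auto)
qed

lemma continuous_on_Cauchy_linepath:
  assumes h: "continuous_on (closed_segment a b) h"
  shows "continuous_on (- closed_segment a b)
    (\<lambda>z. contour_integral (linepath a b) (\<lambda>w. h w / (w - z)))"
proof -
  have "continuous_on (- closed_segment a b)
      (\<lambda>z. integral (cbox 0 1) (\<lambda>t. h (linepath a b t) / (linepath a b t - z) * (b - a)))"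
    by (rule integral_continuous_on_param, unfold cbox_interval, rule continuous_on_Cauchy_kernel[OF h])
      simp
  then show ?thesis
    unfolding contour_integral_linepath_eq_integral cbox_interval .
qed

text \<open>A Riemann sum of the integral is a combination of kernels with poles on the segment,
  each approximable by \<open>ker\<close>. Instead of choosing a partition, an error proportional to
  the length of the parameter interval is shown to be additive under concatenation and attainable on
  short intervals; bisection then gives it on \<open>{0..1}\<close>.\<close>

lemma poly_approx_Cauchy_linepath:
  assumes A: "compact A" "A \<inter> closed_segment a b = {}"
    and h: "continuous_on (closed_segment a b) h"
    and ker: "\<And>w. w \<in> closed_segment a b \<Longrightarrow> poly_approx A (\<lambda>z. 1 / (w - z))"
  shows "poly_approx A (\<lambda>z. contour_integral (linepath a b) (\<lambda>w. h w / (w - z)))"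
proof -
  define \<phi> where "\<phi> z t = h (linepath a b t) / (linepath a b t - z) * (b - a)" for z t
  have cont: "continuous_on (A \<times> {0..1}) (\<lambda>(z, t). \<phi> z t)"
    unfolding \<phi>_def by (rule continuous_on_Cauchy_kernel[OF h A(2)])
  then have unif: "uniformly_continuous_on (A \<times> {0..1}) (\<lambda>(z, t). \<phi> z t)"
    using A(1) by (intro compact_uniformly_continuous compact_Times) auto
  have cont1: "continuous_on {s..t} (\<phi> z)" if "z \<in> A" "0 \<le> s" "t \<le> 1" for z s t
  proof -
    have "continuous_on {s..t} (\<lambda>u. (\<lambda>(z, t). \<phi> z t) (z, u))"
      by (rule continuous_on_compose2[OF cont, of _ "Pair z"], intro continuous_intros) (use that in auto)
    then show ?thesis by simp
  qed
  have "\<exists>p. \<forall>z\<in>A. cmod (integral {0..1} (\<phi> z) - poly p z) < e" if "e > 0" for e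
  proof -
    define P where "P s t \<longleftrightarrow> 0 \<le> s \<longrightarrow> t \<le> 1 \<longrightarrow>
      (\<exists>p. \<forall>z\<in>A. cmod (integral {s..t} (\<phi> z) - poly p z) \<le> e / 2 * (t - s))" for s t
    have "P 0 1"
    proof (rule Bolzano[of 0 1 P])
      fix r s t assume rst: "P r s" "P s t" "r \<le> s" "s \<le> t"
      show "P r t" unfolding P_def
      proof (intro impI)
        assume r: "0 \<le> r" "t \<le> 1"
        obtain p q where p: "\<forall>z\<in>A. cmod (integral {r..s} (\<phi> z) - poly p z) \<le> e / 2 * (s - r)"
          and q: "\<forall>z\<in>A. cmod (integral {s..t} (\<phi> z) - poly q z) \<le> e / 2 * (t - s)"
          using rst r unfolding P_def by auto
        have "cmod (integral {r..t} (\<phi> z) - poly (p + q) z) \<le> e / 2 * (t - r)" if z: "z \<in> A" for z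
        proof -
          have "integral {r..t} (\<phi> z) = integral {r..s} (\<phi> z) + integral {s..t} (\<phi> z)"
            by (rule Henstock_Kurzweil_Integration.integral_combine[symmetric])
              (use rst r cont1[OF z] in \<open>auto intro: integrable_continuous_real\<close>)
          moreover have "cmod ((integral {r..s} (\<phi> z) - poly p z) + (integral {s..t} (\<phi> z) - poly q z))
             \<le> e / 2 * (s - r) + e / 2 * (t - s)"
            using p q z by (intro norm_triangle_mono) auto
          moreover have "e / 2 * (s - r) + e / 2 * (t - s) = e / 2 * (t - r)"
            by (simp add: field_simps)
          ultimately show ?thesis by (simp add: add_diff_add)
        qed
        then show "\<exists>p. \<forall>z\<in>A. cmod (integral {r..t} (\<phi> z) - poly p z) \<le> e / 2 * (t - r)" by blast
      qed
    next
      fix x :: real assume x: "0 \<le> x" "x \<le> 1"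
      \<comment> \<open>Uniform continuity on \<open>A \<times> {0..1}\<close> makes
        \<open>d\<close> independent of \<open>z\<close>. Replacing the integrand by its value at
        \<open>x\<close> costs \<open>e / 4\<close>, replacing that value by a polynomial another
        \<open>e / 4\<close>.\<close>
      obtain d where d: "d > 0" "\<And>z z' t t'. z \<in> A \<Longrightarrow> z' \<in> A \<Longrightarrow> t \<in> {0..1} \<Longrightarrow> t' \<in> {0..1} \<Longrightarrow>
          dist (z', t') (z, t) < d \<Longrightarrow> dist (\<phi> z' t') (\<phi> z t) < e / 4"
        using unif[unfolded uniformly_continuous_on_def, rule_format, of "e / 4"] \<open>e > 0\<close> by auto
      have "poly_approx A (\<lambda>z. (h (linepath a b x) * (b - a)) * (1 / (linepath a b x - z)))"
        using x by (intro poly_approx_cmult ker linepath_in_path) auto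
      then have "poly_approx A (\<lambda>z. \<phi> z x)" by (simp add: \<phi>_def)
      then obtain q where q: "\<forall>z\<in>A. cmod (\<phi> z x - poly q z) < e / 4"
        using \<open>e > 0\<close> unfolding poly_approx_def by (meson divide_pos_pos zero_less_numeral)
      have "P s t" if st: "s \<le> x" "x \<le> t" "t - s < d" for s t
        unfolding P_def
      proof (intro impI)
        assume r: "0 \<le> s" "t \<le> 1"
        have "cmod (integral {s..t} (\<phi> z) - poly (Polynomial.smult (of_real (t - s)) q) z) \<le> e / 2 * (t - s)"
          if z: "z \<in> A" for z
        proof -
          have "integral {s..t} (\<phi> z) - poly (Polynomial.smult (of_real (t - s)) q) z
              = integral {s..t} (\<phi> z) - integral {s..t} (\<lambda>u. poly q z)"
            using st by (simp add: scaleR_conv_of_real)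
          also have "\<dots> = integral {s..t} (\<lambda>u. \<phi> z u - poly q z)"
            using cont1[OF z r] by (intro integral_diff[symmetric] integrable_continuous_real) auto
          also have "cmod \<dots> \<le> e / 2 * (t - s)"
          proof (rule integral_bound)
            show "s \<le> t" using st by simp
            show "continuous_on {s..t} (\<lambda>u. \<phi> z u - poly q z)"
              using cont1[OF z r] by (intro continuous_intros)
            fix u assume u: "u \<in> {s..t}"
            have "dist (z, u) (z, x) < d" using u st by (auto simp: dist_Pair_Pair dist_real_def)
            then have "dist (\<phi> z u) (\<phi> z x) < e / 4" using u st r x z by (intro d) auto
            moreover have "cmod (\<phi> z x - poly q z) < e / 4" using q z by blast
            ultimately have "cmod ((\<phi> z u - \<phi> z x) + (\<phi> z x - poly q z)) < e / 4 + e / 4"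
              by (intro norm_add_less) (auto simp: dist_norm)
            then show "cmod (\<phi> z u - poly q z) \<le> e / 2" by simp
          qed
          finally show ?thesis .
        qed
        then show "\<exists>p. \<forall>z\<in>A. cmod (integral {s..t} (\<phi> z) - poly p z) \<le> e / 2 * (t - s)" by blast
      qed
      then show "\<exists>d>0. \<forall>s t. s \<le> x \<and> x \<le> t \<and> t - s < d \<longrightarrow> P s t" using d(1) by blast
    qed simp
    then obtain p where p: "\<forall>z\<in>A. cmod (integral {0..1} (\<phi> z) - poly p z) \<le> e / 2 * (1 - 0)"
      unfolding P_def by auto
    have "e / 2 * (1 - 0) < e" using \<open>e > 0\<close> by simp
    with p show ?thesis by (meson order.strict_trans1)
  qed
  then show ?thesis
    unfolding poly_approx_def \<phi>_def contour_integral_linepath_eq_integral by blast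
qed

text \<open>The upper and left sides are reversed, so that a side shared by two grid squares is the
  same \<open>linepath\<close> in both formulas and occurs with opposite signs.\<close>

lemma contour_integral_rectpath:
  assumes f: "continuous_on (path_image (rectpath a1 a3)) f"
    and le: "Re a1 \<le> Re a3" "Im a1 \<le> Im a3"
  defines "a2 \<equiv> Complex (Re a3) (Im a1)" and "a4 \<equiv> Complex (Re a1) (Im a3)"
  shows "contour_integral (rectpath a1 a3) f =
    contour_integral (linepath a1 a2) f + contour_integral (linepath a2 a3) f
    - contour_integral (linepath a4 a3) f - contour_integral (linepath a1 a4) f"
proof -
  have im: "path_image (rectpath a1 a3) = closed_segment a1 a2 \<union> closed_segment a2 a3
      \<union> closed_segment a4 a3 \<union> closed_segment a1 a4"
    unfolding rectpath_def Let_def a2_def a4_def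
    by (simp add: path_image_join Un_assoc closed_segment_commute)
  have c: "continuous_on (closed_segment a1 a2) f" "continuous_on (closed_segment a2 a3) f"
    "continuous_on (closed_segment a4 a3) f" "continuous_on (closed_segment a1 a4) f"
    by (rule continuous_on_subset[OF f]; unfold im; blast)+
  then have c': "continuous_on (closed_segment a3 a4) f" "continuous_on (closed_segment a4 a1) f"
    by (simp_all add: closed_segment_commute)
  have "contour_integral (rectpath a1 a3) f =
    contour_integral (linepath a1 a2) f + (contour_integral (linepath a2 a3) f
    + (contour_integral (linepath a3 a4) f + contour_integral (linepath a4 a1) f))"
    unfolding rectpath_def Let_def a2_def[symmetric] a4_def[symmetric]
    by (intro contour_integral_unique has_contour_integral_join has_contour_integral_integral
        contour_integrable_continuous_linepath c c' valid_path_join valid_path_linepath) simp_all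
  moreover have "contour_integral (linepath a3 a4) f = - contour_integral (linepath a4 a3) f"
    by (rule contour_integral_reverse_linepath[OF c'(1)])
  moreover have "contour_integral (linepath a4 a1) f = - contour_integral (linepath a1 a4) f"
    by (rule contour_integral_reverse_linepath[OF c'(2)])
  ultimately show ?thesis by simp
qed

lemma poly_approx_inverse_compact:
  assumes L: "compact L" "connected (- L)" and K: "compact K" "K \<inter> L = {}"
  shows "\<exists>r>0. \<forall>w\<in>K. poly_approx (\<Union>x\<in>L. cball x r) (\<lambda>z. 1 / (w - z))"
proof -
  have "\<forall>w\<in>K. \<exists>d r. d > 0 \<and> r > 0 \<and>
      (\<forall>w'\<in>ball w d. poly_approx (\<Union>x\<in>L. cball x r) (\<lambda>z. 1 / (w' - z)))"
    using poly_approx_inverse_local[OF L] K(2) by blast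
  then obtain d r where dr: "\<And>w. w \<in> K \<Longrightarrow> d w > 0" "\<And>w. w \<in> K \<Longrightarrow> r w > 0"
    "\<And>w w'. w \<in> K \<Longrightarrow> w' \<in> ball w (d w) \<Longrightarrow> poly_approx (\<Union>x\<in>L. cball x (r w)) (\<lambda>z. 1 / (w' - z))"
    by metis
  obtain F where F: "F \<subseteq> K" "finite F" "K \<subseteq> (\<Union>w\<in>F. ball w (d w))"
    by (rule compactE_image[OF K(1), of K "\<lambda>w. ball w (d w)"]) (use dr(1) in auto)
  \<comment> \<open>The element \<open>1\<close> keeps the minimum meaningful when \<open>F\<close>
    is empty.\<close>
  define \<rho> where "\<rho> = Min (insert 1 (r ` F))"
  have "\<rho> > 0" using F dr(2) by (auto simp: \<rho>_def)
  moreover have "poly_approx (\<Union>x\<in>L. cball x \<rho>) (\<lambda>z. 1 / (w - z))" if w: "w \<in> K" for w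
  proof -
    obtain v where v: "v \<in> F" "w \<in> ball v (d v)" using F(3) w by blast
    have "\<rho> \<le> r v" using F(2) v(1) by (auto simp: \<rho>_def)
    then have "(\<Union>x\<in>L. cball x \<rho>) \<subseteq> (\<Union>x\<in>L. cball x (r v))" by force
    then show ?thesis using poly_approx_subset[OF dr(3)] v F(1) by blast
  qed
  ultimately show ?thesis by blast
qed

text \<open>Cauchy's formula is summed over all squares of a fine grid that meet \<open>L\<close>.
  Approximation of \<open>h\<close> only requires the segments to avoid \<open>L\<close>, so the
  remaining edges are kept as a finite signed family and are never joined to closed curves.\<close>

lemma Cauchy_integral_formula_compact:
  fixes h :: "complex \<Rightarrow> complex"
  assumes L: "compact L" "open U" "L \<subseteq> U" and h: "h holomorphic_on U"
  obtains E :: "(bool \<times> int \<times> int) set" and a b c :: "bool \<times> int \<times> int \<Rightarrow> complex"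
  where "finite E" "\<And>e. e \<in> E \<Longrightarrow> closed_segment (a e) (b e) \<subseteq> U - L"
    "\<And>z. z \<in> L \<Longrightarrow> h z = (\<Sum>e\<in>E. c e * contour_integral (linepath (a e) (b e)) (\<lambda>w. h w / (w - z)))"
proof -
  obtain \<epsilon> where \<epsilon>: "\<epsilon> > 0" "(\<Union>x\<in>L. cball x \<epsilon>) \<subseteq> U"
    using compact_subset_open_imp_cball_epsilon_subset[OF L] by blast
  \<comment> \<open>Two points of one square differ by at most \<open>\<delta>\<close> in each
    coordinate, hence by at most \<open>2 * \<delta> = \<epsilon>\<close> in modulus: a square
    meeting \<open>L\<close> lies in \<open>U\<close>.\<close>
  define \<delta> where "\<delta> = \<epsilon> / 2"
  have \<delta>: "\<delta> > 0" using \<epsilon>(1) by (simp add: \<delta>_def)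
  define corner where "corner i j = Complex (\<delta> * of_int i) (\<delta> * of_int j)" for i j :: int
  define Q where "Q i j = cbox (corner i j) (corner (i + 1) (j + 1))" for i j
  define B where "B i j = box (corner i j) (corner (i + 1) (j + 1))" for i j
  have in_Q: "z \<in> Q i j \<longleftrightarrow> \<delta> * of_int i \<le> Re z \<and> Re z \<le> \<delta> * of_int i + \<delta> \<and>
      \<delta> * of_int j \<le> Im z \<and> Im z \<le> \<delta> * of_int j + \<delta>" for z i j
    by (auto simp: Q_def in_cbox_complex_iff corner_def algebra_simps)
  have in_B: "z \<in> B i j \<longleftrightarrow> \<delta> * of_int i < Re z \<and> Re z < \<delta> * of_int i + \<delta> \<and>
      \<delta> * of_int j < Im z \<and> Im z < \<delta> * of_int j + \<delta>" for z i j
    by (auto simp: B_def in_box_complex_iff corner_def algebra_simps)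
  have convQ: "convex (Q i j)" for i j by (simp add: Q_def)
  define S where "S = {(i, j). Q i j \<inter> L \<noteq> {}}"
  have QU: "Q i j \<subseteq> U" if "(i, j) \<in> S" for i j
  proof
    fix z assume z: "z \<in> Q i j"
    obtain x where x: "x \<in> Q i j" "x \<in> L" using \<open>(i, j) \<in> S\<close> by (auto simp: S_def)
    have "\<bar>Re (x - z)\<bar> \<le> \<delta>" "\<bar>Im (x - z)\<bar> \<le> \<delta>" using x(1) z by (auto simp: in_Q)
    then have "cmod (x - z) \<le> \<epsilon>" using cmod_le[of "x - z"] by (simp add: \<delta>_def)
    then have "z \<in> cball x \<epsilon>" by (simp add: dist_norm)
    then show "z \<in> U" using \<epsilon>(2) x(2) by blast
  qed
  have "finite S"
  proof -
    obtain R where R: "\<And>x. x \<in> L \<Longrightarrow> cmod x \<le> R"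
      using compact_imp_bounded[OF L(1)] by (auto simp: bounded_iff)
    define m where "m = \<lceil>R / \<delta>\<rceil> + 1"
    have m: "i \<in> {-m..m}" if "\<delta> * of_int i \<le> x" "x \<le> \<delta> * of_int i + \<delta>" "\<bar>x\<bar> \<le> R" for i and x :: real
    proof -
      have "of_int i \<le> R / \<delta>" "- (R / \<delta>) \<le> of_int i + 1"
        using that \<delta> by (simp_all add: field_simps)
      then have "of_int i \<le> (of_int m :: real)" "- of_int m \<le> (of_int i :: real)"
        unfolding m_def using le_of_int_ceiling[of "R / \<delta>"] by simp_all linarith+
      then show ?thesis by simp
    qed
    have "S \<subseteq> {-m..m} \<times> {-m..m}"
    proof clarify
      fix i j assume "(i, j) \<in> S"
      then obtain x where x: "x \<in> Q i j" "x \<in> L" by (auto simp: S_def)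
      have "\<bar>Re x\<bar> \<le> R" "\<bar>Im x\<bar> \<le> R"
        using R[OF x(2)] abs_Re_le_cmod[of x] abs_Im_le_cmod[of x] by linarith+
      then show "i \<in> {-m..m} \<and> j \<in> {-m..m}" using x(1) m by (simp only: in_Q) blast
    qed
    then show ?thesis by (rule finite_subset) simp
  qed
  have cover: "\<exists>i j. (i, j) \<in> S \<and> z \<in> Q i j" if "z \<in> L" for z
  proof -
    have fl: "\<delta> * of_int \<lfloor>x / \<delta>\<rfloor> \<le> x \<and> x \<le> \<delta> * of_int \<lfloor>x / \<delta>\<rfloor> + \<delta>" for x
    proof -
      have "\<delta> * of_int \<lfloor>x / \<delta>\<rfloor> \<le> \<delta> * (x / \<delta>)" "\<delta> * (x / \<delta>) \<le> \<delta> * (of_int \<lfloor>x / \<delta>\<rfloor> + 1)"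
        using \<delta> by (intro mult_left_mono; linarith)+
      then show ?thesis using \<delta> by (simp add: distrib_left)
    qed
    then have "z \<in> Q \<lfloor>Re z / \<delta>\<rfloor> \<lfloor>Im z / \<delta>\<rfloor>" by (simp add: in_Q)
    then show ?thesis using that by (auto simp: S_def)
  qed
  (* The edge (\<beta>, i, j) starts at corner i j; it is horizontal if \<beta> holds and vertical otherwise.
     P and N collect the edges traversed in positive and negative direction by the boundaries of the
     squares in S; those in both cancel, and a remaining edge borders a square that misses L. *)
  define a where "a = (\<lambda>(\<beta>::bool, i, j). corner i j)"
  define b where "b = (\<lambda>(\<beta>, i, j). if \<beta> then corner (i + 1) j else corner i (j + 1))"
  define I where "I z e = contour_integral (linepath (a e) (b e)) (\<lambda>w. h w / (w - z))" for z e
  define P where "P = (\<lambda>(i, j). (True, i, j)) ` S \<union> (\<lambda>(i, j). (False, i + 1, j)) ` S"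
  define N where "N = (\<lambda>(i, j). (True, i, j + 1)) ` S \<union> (\<lambda>(i, j). (False, i, j)) ` S"
  have PN_iff: "(True, i, j) \<in> P \<longleftrightarrow> (i, j) \<in> S" "(False, i, j) \<in> P \<longleftrightarrow> (i - 1, j) \<in> S"
    "(True, i, j) \<in> N \<longleftrightarrow> (i, j - 1) \<in> S" "(False, i, j) \<in> N \<longleftrightarrow> (i, j) \<in> S" for i j
    unfolding P_def N_def by (force simp: image_iff)+
  have finPN: "finite P" "finite N" using \<open>finite S\<close> by (auto simp: P_def N_def)
  have segT: "closed_segment (a (True, i, j)) (b (True, i, j)) \<subseteq> Q i j"
    "closed_segment (a (True, i, j)) (b (True, i, j)) \<subseteq> Q i (j - 1)"
    "closed_segment (a (False, i, j)) (b (False, i, j)) \<subseteq> Q i j"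
    "closed_segment (a (False, i, j)) (b (False, i, j)) \<subseteq> Q (i - 1) j" for i j
    by (rule closed_segment_subset[OF _ _ convQ];
        use \<delta> in \<open>simp add: a_def b_def in_Q corner_def algebra_simps\<close>)+
  define E where "E = (P - N) \<union> (N - P)"
  define c where "c e = (if e \<in> P then 1 else - 1) / (2 * of_real pi * \<i>)" for e
  have seg: "closed_segment (a e) (b e) \<subseteq> U - L" if "e \<in> E" for e
  proof -
    have mem: "closed_segment x y \<subseteq> U - L"
      if "closed_segment x y \<subseteq> Q i j" "closed_segment x y \<subseteq> Q k l" "(i, j) \<in> S" "(k, l) \<notin> S"
      for x y i j k l
      using that QU[OF that(3)] by (auto simp: S_def)
    obtain \<beta> i j where e: "e = (\<beta>, i, j)" by (cases e) auto
    show ?thesis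
    proof (cases \<beta>)
      case True
      then have "(i, j) \<in> S \<and> (i, j - 1) \<notin> S \<or> (i, j - 1) \<in> S \<and> (i, j) \<notin> S"
        using that by (auto simp: e E_def PN_iff)
      then show ?thesis
        unfolding e using True mem[OF segT(1)[of i j] segT(2)[of i j]] mem[OF segT(2)[of i j] segT(1)[of i j]]
        by (elim disjE conjE) simp_all
    next
      case False
      then have "(i, j) \<in> S \<and> (i - 1, j) \<notin> S \<or> (i - 1, j) \<in> S \<and> (i, j) \<notin> S"
        using that by (auto simp: e E_def PN_iff)
      then show ?thesis
        unfolding e using False mem[OF segT(3)[of i j] segT(4)[of i j]] mem[OF segT(4)[of i j] segT(3)[of i j]]
        by (elim disjE conjE) simp_all
    qed
  qed
  define G where "G z = (\<Sum>e\<in>E. c e * I z e)" for z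
  \<comment> \<open>A point in the interior of one square lies in no other closed square. Only its
    own square contributes to the sum over \<open>S\<close>, namely
    \<open>2 * of_real pi * \<i> * h z\<close>; for all others the integrand is holomorphic on the
    square.\<close>
  have inner: "G z = h z" if S0: "(i0, j0) \<in> S" and z: "z \<in> B i0 j0" for i0 j0 z
  proof -
    have zQ: "z \<notin> Q i j" if "(i, j) \<noteq> (i0, j0)" for i j
    proof
      assume "z \<in> Q i j"
      have eq: "k = l" if "\<delta> * of_int k \<le> x" "x \<le> \<delta> * of_int k + \<delta>" "\<delta> * of_int l < x" "x < \<delta> * of_int l + \<delta>"
        for k l :: int and x :: real
      proof -
        have "\<delta> * of_int k < \<delta> * (of_int l + 1)" "\<delta> * of_int l < \<delta> * (of_int k + 1)"
          using that by (simp_all add: algebra_simps)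
        then have "real_of_int k < of_int l + 1" "real_of_int l < of_int k + 1"
          using \<delta> by (simp_all only: mult_less_cancel_left_pos)
        then show ?thesis by linarith
      qed
      have "i = i0"
        by (rule eq[of i "Re z"]) (use \<open>z \<in> Q i j\<close> z in \<open>simp_all add: in_Q in_B\<close>)
      moreover have "j = j0"
        by (rule eq[of j "Im z"]) (use \<open>z \<in> Q i j\<close> z in \<open>simp_all add: in_Q in_B\<close>)
      ultimately show False using that by simp
    qed
    have sq: "I z (True, i, j) + I z (False, i + 1, j) - I z (True, i, j + 1) - I z (False, i, j)
        = (if (i, j) = (i0, j0) then 2 * of_real pi * \<i> * h z else 0)" if ij: "(i, j) \<in> S" for i j
    proof -
      define \<gamma> where "\<gamma> = rectpath (corner i j) (corner (i + 1) (j + 1))"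
      have le: "Re (corner i j) < Re (corner (i + 1) (j + 1))" "Im (corner i j) < Im (corner (i + 1) (j + 1))"
        using \<delta> by (simp_all add: corner_def algebra_simps)
      have imQ: "path_image \<gamma> \<subseteq> Q i j"
        unfolding \<gamma>_def Q_def by (rule path_image_rectpath_subset_cbox) (use le in auto)
      have zim: "z \<notin> path_image \<gamma>"
      proof (cases "(i, j) = (i0, j0)")
        case True
        then have "z \<in> B i j" using z by simp
        moreover have "path_image \<gamma> \<inter> B i j = {}"
          unfolding \<gamma>_def B_def by (rule path_image_rectpath_inter_box) (use le in auto)
        ultimately show ?thesis by blast
      qed (use zQ imQ in blast)
      have hQ: "h holomorphic_on Q i j" using h QU[OF ij] by (rule holomorphic_on_subset)
      have "continuous_on (path_image \<gamma>) (\<lambda>w. h w / (w - z))"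
        by (intro continuous_on_divide continuous_on_diff continuous_on_id continuous_on_const
            continuous_on_subset[OF holomorphic_on_imp_continuous_on[OF hQ] imQ]) (use zim in auto)
      then have "contour_integral \<gamma> (\<lambda>w. h w / (w - z)) =
          I z (True, i, j) + I z (False, i + 1, j) - I z (True, i, j + 1) - I z (False, i, j)"
        unfolding \<gamma>_def I_def using le
        by (subst contour_integral_rectpath) (auto simp: a_def b_def corner_def)
      moreover have "contour_integral \<gamma> (\<lambda>w. h w / (w - z)) =
          (if (i, j) = (i0, j0) then 2 * of_real pi * \<i> * h z else 0)"
      proof (cases "(i, j) = (i0, j0)")
        case True
        have zB: "z \<in> box (corner i j) (corner (i + 1) (j + 1))" using z True by (simp add: B_def)
        have "((\<lambda>w. h w / (w - z)) has_contour_integral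
            (of_real (2 * pi) * \<i> * winding_number \<gamma> z * h z)) \<gamma>"
        proof (rule Cauchy_integral_formula_convex_simple[OF convQ hQ])
          show "z \<in> interior (Q i j)" using zB by (simp add: Q_def interior_cbox)
          show "path_image \<gamma> \<subseteq> Q i j - {z}" using imQ zim by blast
        qed (auto simp: \<gamma>_def)
        moreover have "winding_number \<gamma> z = 1"
          unfolding \<gamma>_def by (rule winding_number_rectpath[OF zB])
        ultimately show ?thesis using True by (simp add: contour_integral_unique)
      next
        case False
        then have "z \<notin> Q i j" by (rule zQ)
        then have "(\<lambda>w. h w / (w - z)) holomorphic_on Q i j"
          by (intro holomorphic_intros hQ) auto
        then have "((\<lambda>w. h w / (w - z)) has_contour_integral 0) \<gamma>"
          by (rule Cauchy_theorem_convex_simple[OF _ convQ _ imQ]) (auto simp: \<gamma>_def)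
        then show ?thesis using False by (auto simp: contour_integral_unique)
      qed
      ultimately show ?thesis by simp
    qed
    have sumP: "sum (I z) P = (\<Sum>(i, j)\<in>S. I z (True, i, j) + I z (False, i + 1, j))"
    proof -
      have "sum (I z) P = sum (I z) ((\<lambda>(i, j). (True, i, j)) ` S) + sum (I z) ((\<lambda>(i, j). (False, i + 1, j)) ` S)"
        unfolding P_def by (rule sum.union_disjoint) (use \<open>finite S\<close> in auto)
      then show ?thesis
        by (subst (asm) (1 2) sum.reindex) (auto simp: inj_on_def sum.distrib case_prod_unfold o_def)
    qed
    have sumN: "sum (I z) N = (\<Sum>(i, j)\<in>S. I z (True, i, j + 1) + I z (False, i, j))"
    proof -
      have "sum (I z) N = sum (I z) ((\<lambda>(i, j). (True, i, j + 1)) ` S) + sum (I z) ((\<lambda>(i, j). (False, i, j)) ` S)"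
        unfolding N_def by (rule sum.union_disjoint) (use \<open>finite S\<close> in auto)
      then show ?thesis
        by (subst (asm) (1 2) sum.reindex) (auto simp: inj_on_def sum.distrib case_prod_unfold o_def)
    qed
    have "sum (I z) P - sum (I z) N = (\<Sum>x\<in>S. if x = (i0, j0) then 2 * of_real pi * \<i> * h z else 0)"
      unfolding sumP sumN sum_subtractf[symmetric]
    proof (rule sum.cong[OF refl])
      fix x assume "x \<in> S"
      then obtain i j where x: "x = (i, j)" "(i, j) \<in> S" by (cases x) auto
      show "(case x of (i, j) \<Rightarrow> I z (True, i, j) + I z (False, i + 1, j))
          - (case x of (i, j) \<Rightarrow> I z (True, i, j + 1) + I z (False, i, j))
          = (if x = (i0, j0) then 2 * of_real pi * \<i> * h z else 0)"
        using sq[OF x(2)] unfolding x(1) prod.case diff_diff_eq .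
    qed
    also have "\<dots> = 2 * of_real pi * \<i> * h z"
      using S0 \<open>finite S\<close> by simp
    finally have PN: "sum (I z) P - sum (I z) N = 2 * of_real pi * \<i> * h z" .
    have "G z = (\<Sum>e\<in>P - N. c e * I z e) + (\<Sum>e\<in>N - P. c e * I z e)"
      unfolding G_def E_def by (rule sum.union_disjoint) (use finPN in auto)
    also have "\<dots> = (sum (I z) (P - N) - sum (I z) (N - P)) / (2 * of_real pi * \<i>)"
      by (simp add: c_def diff_divide_distrib sum_divide_distrib sum_negf)
    also have "sum (I z) (P - N) - sum (I z) (N - P) = sum (I z) P - sum (I z) N"
      using sum.Int_Diff[OF finPN(1), of "I z" N] sum.Int_Diff[OF finPN(2), of "I z" P]
      by (simp add: Int_commute)
    finally show ?thesis unfolding PN by simp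
  qed
  define V where "V = U - (\<Union>e\<in>E. closed_segment (a e) (b e))"
  have "open V"
    unfolding V_def using finPN L(2)
    by (intro open_Diff closed_UN closed_segment) (auto simp: E_def)
  have "continuous_on V G"
  proof -
    have "continuous_on (- closed_segment (a e) (b e)) (\<lambda>z. I z e)" if "e \<in> E" for e
      unfolding I_def
      by (rule continuous_on_Cauchy_linepath)
        (use seg[OF that] holomorphic_on_imp_continuous_on[OF h] in \<open>blast intro: continuous_on_subset\<close>)
    then have "continuous_on V (\<lambda>z. I z e)" if "e \<in> E" for e
      by (rule continuous_on_subset) (use that in \<open>auto simp: V_def\<close>)
    then show ?thesis unfolding G_def by (intro continuous_on_sum continuous_on_mult continuous_on_const)
  qed
  then have contV: "continuous_on V (\<lambda>z. G z - h z)"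
    using holomorphic_on_imp_continuous_on[OF h] unfolding V_def
    by (intro continuous_on_diff) (auto elim: continuous_on_subset)
  \<comment> \<open>A point of \<open>L\<close> may lie on a grid line, even on a cancelled edge,
    where the individual square integrals are singular. It avoids the edges in \<open>E\<close>, so
    \<open>G - h\<close> is continuous near it and vanishes on the adjacent interior of a square in
    \<open>S\<close>.\<close>
  have "h z = G z" if z: "z \<in> L" for z
  proof -
    have "z \<in> V" unfolding V_def using z L(3) seg by blast
    then obtain \<rho> where \<rho>: "\<rho> > 0" "cball z \<rho> \<subseteq> V"
      using \<open>open V\<close> open_contains_cball by blast
    obtain i j where ij: "(i, j) \<in> S" "z \<in> Q i j" using cover[OF z] by blast
    define T where "T = ball z \<rho> \<inter> B i j"
    have "box (corner i j) (corner (i + 1) (j + 1)) \<noteq> {}"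
    proof -
      have "Complex (\<delta> * of_int i + \<delta> / 2) (\<delta> * of_int j + \<delta> / 2) \<in> B i j"
        using \<delta> by (simp add: in_B)
      then show ?thesis by (auto simp: B_def)
    qed
    then have "closure (B i j) = Q i j" unfolding B_def Q_def by (rule closure_box)
    then have "z \<in> closure T"
      using open_Int_closure_subset[of "ball z \<rho>" "B i j"] ij(2) \<rho>(1) by (auto simp: T_def)
    have "closure T \<subseteq> cball z \<rho>"
      by (rule closure_minimal) (auto simp: T_def)
    then have "continuous_on (closure T) (\<lambda>z. G z - h z)"
      using contV \<rho>(2) by (blast intro: continuous_on_subset)
    then have "G z - h z = 0"
      by (rule continuous_constant_on_closure) (use inner[OF ij(1)] \<open>z \<in> closure T\<close> in \<open>auto simp: T_def\<close>)
    then show ?thesis by simp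
  qed
  then show ?thesis
    using finPN seg unfolding G_def I_def by (intro that[of E a b c]) (simp_all add: E_def)
qed

text \<open>The integral formula is applied to a thickening of \<open>L\<close>, so that it
  represents \<open>h\<close> on a neighbourhood. Pole pushing uses the connected complement of
  \<open>L\<close> itself and yields its own radius \<open>r1\<close>, uniform over the compact set
  \<open>K\<close> of poles; the smaller radius serves both.\<close>

theorem Runge_polynomial:
  assumes L: "compact L" "connected (- L)" and U: "open U" "L \<subseteq> U" and h: "h holomorphic_on U"
  shows "\<exists>r>0. (\<Union>x\<in>L. cball x r) \<subseteq> U \<and> poly_approx (\<Union>x\<in>L. cball x r) h"
proof -
  obtain r0 where r0: "r0 > 0" "(\<Union>x\<in>L. cball x r0) \<subseteq> U"
    using compact_subset_open_imp_cball_epsilon_subset[OF L(1) U] by blast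
  have "compact (\<Union>x\<in>L. cball x r0)" by (rule compact_minkowski_sum_cball[OF L(1)])
  then obtain E :: "(bool \<times> int \<times> int) set" and a b c where E: "finite E"
    "\<And>e. e \<in> E \<Longrightarrow> closed_segment (a e) (b e) \<subseteq> U - (\<Union>x\<in>L. cball x r0)"
    "\<And>z. z \<in> (\<Union>x\<in>L. cball x r0) \<Longrightarrow>
      h z = (\<Sum>e\<in>E. c e * contour_integral (linepath (a e) (b e)) (\<lambda>w. h w / (w - z)))"
    using Cauchy_integral_formula_compact[OF _ U(1) r0(2) h] by blast
  define K where "K = (\<Union>e\<in>E. closed_segment (a e) (b e))"
  have "compact K" unfolding K_def using E(1) by (intro compact_UN) auto
  moreover have "K \<inter> L = {}" using E(2) r0(1) unfolding K_def by fastforce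
  ultimately obtain r1 where r1: "r1 > 0" "\<And>w. w \<in> K \<Longrightarrow> poly_approx (\<Union>x\<in>L. cball x r1) (\<lambda>z. 1 / (w - z))"
    using poly_approx_inverse_compact[OF L] by meson
  define r where "r = min r0 r1"
  define A where "A = (\<Union>x\<in>L. cball x r)"
  have A: "A \<subseteq> (\<Union>x\<in>L. cball x r0)" "A \<subseteq> (\<Union>x\<in>L. cball x r1)" "compact A"
    unfolding A_def by (auto simp: r_def intro: compact_minkowski_sum_cball[OF L(1)])
  have "poly_approx A (\<lambda>z. \<Sum>e\<in>E. c e * contour_integral (linepath (a e) (b e)) (\<lambda>w. h w / (w - z)))"
  proof (intro poly_approx_sum poly_approx_cmult poly_approx_Cauchy_linepath[OF A(3)])
    fix e assume e: "e \<in> E"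
    show "A \<inter> closed_segment (a e) (b e) = {}" using A(1) E(2)[OF e] by blast
    show "continuous_on (closed_segment (a e) (b e)) h"
      using holomorphic_on_imp_continuous_on[OF h] E(2)[OF e] by (blast intro: continuous_on_subset)
    show "poly_approx A (\<lambda>z. 1 / (w - z))" if "w \<in> closed_segment (a e) (b e)" for w
      using that e by (intro poly_approx_subset[OF r1(2) A(2)]) (auto simp: K_def)
  qed
  then have "poly_approx A h"
    using poly_approx_cong[of A h] E(3) A(1) by (meson subsetD)
  moreover have "r > 0" using r0 r1 by (simp add: r_def)
  ultimately show ?thesis using A(1) r0(2) unfolding A_def by blast
qed

lemma higher_deriv_bound:
  assumes f: "f holomorphic_on cball z r" and B: "\<And>w. w \<in> cball z r \<Longrightarrow> cmod (f w) < B" and r: "r > 0"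
  shows "cmod ((deriv ^^ n) f z) \<le> fact n * B / r ^ n"
proof (cases "n = 0")
  case True
  then show ?thesis using B[of z] r by simp
next
  case False
  show ?thesis
    by (rule Cauchy_higher_deriv_bound[of f z r 0])
      (use assms False in \<open>auto simp: holomorphic_on_imp_continuous_on intro: holomorphic_on_subset\<close>)
qed

lemma Runge_polynomial_derivs:
  assumes L: "compact L" "connected (- L)" and U: "open U" "L \<subseteq> U" and h: "h holomorphic_on U"
    and e: "e > 0"
  shows "\<exists>P. \<forall>l\<le>n. \<forall>z\<in>L. cmod ((deriv ^^ l) (poly P) z - (deriv ^^ l) h z) \<le> e"
proof -
  obtain r where r: "r > 0" "(\<Union>x\<in>L. cball x r) \<subseteq> U" "poly_approx (\<Union>x\<in>L. cball x r) h"
    using Runge_polynomial[OF L U h] by blast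
  have holh: "h holomorphic_on cball z r" if "z \<in> L" for z
    using h r(2) that by (blast intro: holomorphic_on_subset)
  \<comment> \<open>An upper bound for the Cauchy constants \<open>fact l / r ^ l\<close> of all
    orders \<open>l \<le> n\<close> at once.\<close>
  define C where "C = (\<Sum>l\<le>n. fact l / r ^ l)"
  have C: "C > 0" unfolding C_def using r(1) by (intro sum_pos) auto
  then obtain P where P: "\<forall>z\<in>(\<Union>x\<in>L. cball x r). cmod (h z - poly P z) < e / C"
    using r(3) e unfolding poly_approx_def by (meson divide_pos_pos)
  have "cmod ((deriv ^^ l) (poly P) z - (deriv ^^ l) h z) \<le> e" if l: "l \<le> n" and z: "z \<in> L" for l z
  proof -
    have "(deriv ^^ l) (poly P) z - (deriv ^^ l) h z = (deriv ^^ l) (\<lambda>w. poly P w - h w) z"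
      by (rule higher_deriv_diff[OF poly_holomorphic_on[OF holomorphic_on_ident]
            holomorphic_on_subset[OF holh[OF z] ball_subset_cball] open_ball, symmetric])
        (use r(1) in simp)
    also have "cmod \<dots> \<le> fact l * (e / C) / r ^ l"
    proof (rule higher_deriv_bound[OF _ _ r(1)])
      show "(\<lambda>w. poly P w - h w) holomorphic_on cball z r"
        by (intro holomorphic_on_diff holh[OF z] poly_holomorphic_on holomorphic_on_ident)
      show "cmod (poly P w - h w) < e / C" if "w \<in> cball z r" for w
        by (subst norm_minus_commute, rule P[rule_format]) (use that z in blast)
    qed
    also have "\<dots> = (e / C) * (fact l / r ^ l)" by simp
    also have "\<dots> \<le> (e / C) * C"
    proof (rule mult_left_mono)
      show "fact l / r ^ l \<le> C"
        unfolding C_def using l r(1) by (intro member_le_sum) auto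
    qed (use e C in simp)
    finally show ?thesis using C by simp
  qed
  then show ?thesis by blast
qed

section \<open>Pade approximants and Hankel determinants\<close>

definition hankel_mat :: "(nat \<Rightarrow> complex) \<Rightarrow> nat \<Rightarrow> nat \<Rightarrow> complex mat" where
  "hankel_mat a p q = Matrix.mat q q (\<lambda>(i, j).
     let k = int p - int q + int i + int j + 1 in if k < 0 then 0 else a (nat k))"

lemma hankel_mat_carrier [simp]: "hankel_mat a p q \<in> carrier_mat q q"
  by (simp add: hankel_mat_def)

lemma hankel_det_eq: "hankel_det a p q = Determinant.det (hankel_mat a p q)"
  by (simp add: hankel_det_def hankel_mat_def)

text \<open>Column \<open>q - v\<close> belongs to the denominator coefficient of order
  \<open>v\<close>: the unknowns run through the columns in reverse order. Row \<open>i\<close>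
  belongs to the condition at order \<open>p + i + 1\<close>.\<close>

lemma hankel_mat_index:
  assumes "i < q" "v \<in> {1..q}"
  shows "hankel_mat a p q $$ (i, q - v) = (if v \<le> p + i + 1 then a (p + i + 1 - v) else 0)"
proof -
  have k: "int p - int q + int i + int (q - v) + 1 = int (p + i + 1) - int v"
    using assms by (simp add: of_nat_diff)
  have "hankel_mat a p q $$ (i, q - v) =
      (let k = int p - int q + int i + int (q - v) + 1 in if k < 0 then 0 else a (nat k))"
    unfolding hankel_mat_def by (subst index_mat) (use assms in auto)
  moreover have "nat (int (p + i + 1) - int v) = p + i + 1 - v" by simp
  ultimately show ?thesis
    unfolding k Let_def by (simp only:) auto
qed

text \<open>The row sum is a Cauchy product coefficient without its term of index 0. With constant
  coefficient 1 its vanishing is the inhomogeneous Pade system for the denominator; with constant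
  coefficient 0 it is the homogeneous one.\<close>

lemma hankel_row:
  assumes M: "degree M \<le> q" and i: "i < q"
  shows "(\<Sum>j<q. hankel_mat a p q $$ (i, j) * coeff M (q - j)) =
    fps_nth (fps_of_poly M * Abs_fps a) (p + i + 1) - coeff M 0 * a (p + i + 1)"
proof -
  define n where "n = p + i + 1"
  have "(\<Sum>j<q. hankel_mat a p q $$ (i, j) * coeff M (q - j)) =
      (\<Sum>v\<in>{1..q}. hankel_mat a p q $$ (i, q - v) * coeff M v)"
    by (rule sum.reindex_bij_witness[of _ "\<lambda>v. q - v" "\<lambda>j. q - j"]) auto
  also have "\<dots> = (\<Sum>v\<in>{1..q}. if v \<le> n then coeff M v * a (n - v) else 0)"
    using hankel_mat_index[OF i] by (intro sum.cong) (auto simp: n_def)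
  also have "\<dots> = (\<Sum>v\<in>{1..q} \<inter> {v. v \<le> n}. coeff M v * a (n - v))"
    by (simp add: sum.inter_restrict)
  also have "\<dots> = (\<Sum>v\<in>{1..n}. coeff M v * a (n - v))"
  proof (rule sum.mono_neutral_left)
    show "\<forall>v\<in>{1..n} - {1..q} \<inter> {v. v \<le> n}. coeff M v * a (n - v) = 0"
    proof
      fix v assume "v \<in> {1..n} - {1..q} \<inter> {v. v \<le> n}"
      then have "v > q" by auto
      then show "coeff M v * a (n - v) = 0" using M by (simp add: coeff_eq_0)
    qed
  qed auto
  also have "\<dots> = (\<Sum>v=0..n. coeff M v * a (n - v)) - coeff M 0 * a n"
    by (simp add: sum.atLeast_Suc_atMost)
  finally show ?thesis by (simp add: fps_mult_nth n_def)
qed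

text \<open>Triviality of the kernel of a nonsingular Hankel matrix, in terms of polynomials.
  Uniqueness of the approximant and coprimality of numerator and denominator both reduce to
  it.\<close>

lemma hankel_det_nonzero_imp_eq_0:
  assumes det: "hankel_det a p q \<noteq> 0" and M: "degree M \<le> q" "coeff M 0 = 0"
    and zero: "\<And>k. p < k \<Longrightarrow> k \<le> p + q \<Longrightarrow> fps_nth (fps_of_poly M * Abs_fps a) k = 0"
  shows "M = 0"
proof -
  define x where "x = Matrix.vec q (\<lambda>j. coeff M (q - j))"
  have "hankel_mat a p q *\<^sub>v x = 0\<^sub>v q"
  proof (rule eq_vecI)
    fix i assume "i < dim_vec (0\<^sub>v q :: complex vec)"
    then have i: "i < q" by simp
    have "(hankel_mat a p q *\<^sub>v x) $ i = (\<Sum>j<q. hankel_mat a p q $$ (i, j) * coeff M (q - j))"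
      using i carrier_matD[OF hankel_mat_carrier[of a p q]]
      by (simp add: scalar_prod_def x_def atLeast0LessThan)
    also have "\<dots> = 0"
      using zero[of "p + i + 1"] i by (simp add: hankel_row[OF M(1) i] M(2))
    finally show "(hankel_mat a p q *\<^sub>v x) $ i = 0\<^sub>v q $ i" using i by simp
  qed (use carrier_matD[OF hankel_mat_carrier[of a p q]] in simp)
  then have x0: "x = 0\<^sub>v q"
    using det det_0_iff_vec_prod_zero[OF hankel_mat_carrier[of a p q]]
    unfolding hankel_det_eq by (metis vec_carrier x_def)
  show "M = 0"
  proof (rule poly_eqI)
    fix v
    show "coeff M v = coeff 0 v"
    proof (cases "v \<in> {1..q}")
      case True
      then have "coeff M v = x $ (q - v)" by (simp add: x_def)
      then show ?thesis using x0 True by simp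
    next
      case False
      then show ?thesis using M by (cases "v = 0") (auto simp: coeff_eq_0)
    qed
  qed
qed

text \<open>
  Cramer's rule for the Hankel system, which makes the coefficients rational functions of \<open>a\<close>;
  junk when \<open>hankel_det a p q = 0\<close>.
\<close>

definition pade_den :: "(nat \<Rightarrow> complex) \<Rightarrow> nat \<Rightarrow> nat \<Rightarrow> complex poly" where
  "pade_den a p q = (\<Sum>v\<le>q. monom (if v = 0 then 1 else
     (\<Sum>k<q. adj_mat (hankel_mat a p q) $$ (q - v, k) * (- a (p + k + 1))) / hankel_det a p q) v)"

definition pade_num :: "(nat \<Rightarrow> complex) \<Rightarrow> nat \<Rightarrow> nat \<Rightarrow> complex poly" where
  "pade_num a p q = (\<Sum>k\<le>p. monom (fps_nth (fps_of_poly (pade_den a p q) * Abs_fps a) k) k)"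

lemma coeff_sum_monom: "coeff (\<Sum>v\<le>n. monom (c v) v) k = (if k \<le> n then c k else 0)"
  by (simp add: coeff_sum)

lemma degree_sum_monom: "degree (\<Sum>v\<le>n. monom (c v) v) \<le> n"
  by (rule degree_le) (simp add: coeff_sum)

lemma pade_den_props:
  "degree (pade_den a p q) \<le> q" "coeff (pade_den a p q) 0 = 1" "degree (pade_num a p q) \<le> p"
  by (simp_all add: pade_den_def pade_num_def degree_sum_monom coeff_sum_monom)

text \<open>Up to order \<open>p\<close> this is the choice of the numerator as a truncated product.
  At order \<open>p + i + 1\<close> it is row \<open>i\<close> of the linear system, solved by
  \<open>?H * adj_mat ?H = hankel_det a p q \<cdot>\<^sub>m 1\<^sub>m q\<close>.\<close>

lemma pade_den_num_eq:
  assumes det: "hankel_det a p q \<noteq> 0" and k: "k \<le> p + q"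
  shows "coeff (pade_num a p q) k = fps_nth (fps_of_poly (pade_den a p q) * Abs_fps a) k"
proof (cases "k \<le> p")
  case True
  then show ?thesis by (simp add: pade_num_def coeff_sum_monom)
next
  case False
  define i where "i = k - p - 1"
  have i: "i < q" "k = p + i + 1" using False k by (auto simp: i_def)
  let ?H = "hankel_mat a p q"
  have H: "?H * adj_mat ?H = hankel_det a p q \<cdot>\<^sub>m 1\<^sub>m q" "adj_mat ?H \<in> carrier_mat q q"
    using adj_mat[OF hankel_mat_carrier[of a p q]] by (simp_all add: hankel_det_eq)
  have HH: "(\<Sum>j<q. ?H $$ (i, j) * adj_mat ?H $$ (j, l)) = (if i = l then hankel_det a p q else 0)"
    if "l < q" for l
  proof -
    have "(?H * adj_mat ?H) $$ (i, l) = (\<Sum>j<q. ?H $$ (i, j) * adj_mat ?H $$ (j, l))"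
      using i(1) that carrier_matD[OF H(2)] carrier_matD[OF hankel_mat_carrier[of a p q]]
      by (simp add: scalar_prod_def atLeast0LessThan)
    then show ?thesis using i(1) that by (cases "i = l") (simp_all add: H(1))
  qed
  have "(\<Sum>j<q. ?H $$ (i, j) * coeff (pade_den a p q) (q - j)) =
      (\<Sum>j<q. ?H $$ (i, j) * ((\<Sum>l<q. adj_mat ?H $$ (j, l) * (- a (p + l + 1))) / hankel_det a p q))"
    by (intro sum.cong) (auto simp: pade_den_def coeff_sum_monom)
  also have "\<dots> = (\<Sum>j<q. \<Sum>l<q. ?H $$ (i, j) * adj_mat ?H $$ (j, l) * (- a (p + l + 1))) / hankel_det a p q"
    by (simp add: sum_divide_distrib sum_distrib_left mult.assoc)
  also have "(\<Sum>j<q. \<Sum>l<q. ?H $$ (i, j) * adj_mat ?H $$ (j, l) * (- a (p + l + 1))) =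
      (\<Sum>l<q. (\<Sum>j<q. ?H $$ (i, j) * adj_mat ?H $$ (j, l)) * (- a (p + l + 1)))"
    by (subst sum.swap) (simp only: sum_distrib_right)
  also have "\<dots> = (\<Sum>l<q. if i = l then hankel_det a p q * (- a (p + l + 1)) else 0)"
    using HH by (intro sum.cong) auto
  also have "\<dots> = hankel_det a p q * (- a (p + i + 1))" using i(1) by simp
  finally have "fps_nth (fps_of_poly (pade_den a p q) * Abs_fps a) k = 0"
    using det hankel_row[OF pade_den_props(1) i(1), of a p a p] unfolding i(2)
    by (simp add: pade_den_props(2))
  moreover have "coeff (pade_num a p q) k = 0"
    using False by (simp add: pade_num_def coeff_sum_monom)
  ultimately show ?thesis by simp
qed

section \<open>Pade conditions in formal power series, coprimality and uniqueness\<close>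

lemma fps_mult_nth_cong:
  assumes "\<And>k. k \<le> n \<Longrightarrow> fps_nth f k = fps_nth g k" "k \<le> n"
  shows "fps_nth (h * f) k = fps_nth (h * g) k"
  using assms by (simp add: fps_mult_nth)

lemma taylor_ratfun:
  assumes "coeff Q 0 = 1"
  shows "(deriv ^^ v) (ratfun \<zeta> (P, Q)) \<zeta> / fact v = fps_nth (fps_of_poly P / fps_of_poly Q) v"
proof -
  have "poly P has_fps_expansion fps_of_poly P" for P :: "complex poly"
  proof -
    have "eval_fps (fps_of_poly P) = poly P" by (rule ext) simp
    then show ?thesis using eval_fps_has_fps_expansion[of "fps_of_poly P"] by simp
  qed
  then have "(\<lambda>x. poly P x / poly Q x) has_fps_expansion (fps_of_poly P / fps_of_poly Q)"
    using assms by (intro has_fps_expansion_divide') auto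
  moreover have "(deriv ^^ v) (ratfun \<zeta> (P, Q)) \<zeta> = (deriv ^^ v) (\<lambda>x. poly P x / poly Q x) 0"
    by (subst higher_deriv_shift_0) (simp add: ratfun_def o_def)
  ultimately show ?thesis by (simp add: fps_nth_fps_expansion)
qed

text \<open>\<open>Q\<close> is invertible as a power series, and multiplication by \<open>Q\<close>
  or by its inverse preserves agreement up to a given order. The conditions on the Taylor
  coefficients of \<open>P / Q\<close> thus become linear in the coefficients of \<open>P\<close>
  and \<open>Q\<close>.\<close>

lemma is_pade_iff:
  "is_pade a \<zeta> p q (P, Q) \<longleftrightarrow> degree P \<le> p \<and> degree Q \<le> q \<and> coeff Q 0 = 1 \<and> coprime P Q \<and>
     (\<forall>k\<le>p + q. coeff P k = fps_nth (fps_of_poly Q * Abs_fps a) k)"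
proof -
  have "(\<forall>v\<le>p + q. fps_nth (fps_of_poly P / fps_of_poly Q) v = a v) \<longleftrightarrow>
      (\<forall>k\<le>p + q. coeff P k = fps_nth (fps_of_poly Q * Abs_fps a) k)" if Q: "coeff Q 0 = 1"
  proof -
    define F where "F = fps_of_poly P / fps_of_poly Q"
    have Q0: "fps_nth (fps_of_poly Q) 0 \<noteq> 0" using Q by simp
    then have QF: "fps_of_poly Q * F = fps_of_poly P"
      unfolding F_def by (metis dvd_mult_div_cancel fps_unit_dvd)
    have inv: "inverse (fps_of_poly Q) * (fps_of_poly Q * G) = G" for G
      using Q0 inverse_mult_eq_1[of "fps_of_poly Q"] by (simp add: mult.assoc[symmetric])
    show ?thesis
    proof
      assume "\<forall>v\<le>p + q. fps_nth (fps_of_poly P / fps_of_poly Q) v = a v"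
      then have "fps_nth (fps_of_poly Q * F) k = fps_nth (fps_of_poly Q * Abs_fps a) k" if "k \<le> p + q" for k
        by (intro fps_mult_nth_cong[OF _ that]) (simp add: F_def)
      then show "\<forall>k\<le>p + q. coeff P k = fps_nth (fps_of_poly Q * Abs_fps a) k" by (simp add: QF)
    next
      assume r: "\<forall>k\<le>p + q. coeff P k = fps_nth (fps_of_poly Q * Abs_fps a) k"
      have "fps_nth (inverse (fps_of_poly Q) * (fps_of_poly Q * F)) v =
          fps_nth (inverse (fps_of_poly Q) * (fps_of_poly Q * Abs_fps a)) v" if "v \<le> p + q" for v
        by (rule fps_mult_nth_cong[OF _ that]) (use r in \<open>simp add: QF\<close>)
      then show "\<forall>v\<le>p + q. fps_nth (fps_of_poly P / fps_of_poly Q) v = a v"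
        unfolding inv F_def by simp
    qed
  qed
  then show ?thesis
    by (auto simp: is_pade_def taylor_ratfun)
qed

text \<open>
  If \<open>g\<close> divided both \<open>P\<close> and \<open>Q\<close>, then \<open>X Q/g\<close> would be a nonzero solution of the homogeneous
  Hankel system.
\<close>

lemma coprime_of_hankel_det_nonzero:
  assumes det: "hankel_det a p q \<noteq> 0"
    and P: "degree P \<le> p" and Q: "degree Q \<le> q" "coeff Q 0 = 1"
    and eq: "\<And>k. k \<le> p + q \<Longrightarrow> coeff P k = fps_nth (fps_of_poly Q * Abs_fps a) k"
  shows "coprime P Q"
proof (rule coprimeI)
  fix g assume "g dvd P" "g dvd Q"
  then obtain P' Q' where P': "P = g * P'" and Q': "Q = g * Q'" by (auto elim!: dvdE)
  have ne: "g \<noteq> 0" "Q' \<noteq> 0" using Q(2) Q' by auto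
  have g0: "coeff g 0 \<noteq> 0" using Q(2) by (auto simp: Q' coeff_mult)
  show "is_unit g"
  proof (rule ccontr)
    assume "\<not> is_unit g"
    then have dg: "degree g > 0" using ne(1) by (simp add: is_unit_iff_degree)
    let ?A = "Abs_fps a"
    have inv: "inverse (fps_of_poly g) * (fps_of_poly g * G) = G" for G
      using g0 inverse_mult_eq_1[of "fps_of_poly g"] by (simp add: mult.assoc[symmetric])
    have eq': "coeff P' k = fps_nth (fps_of_poly Q' * ?A) k" if "k \<le> p + q" for k
    proof -
      have "fps_nth (inverse (fps_of_poly g) * (fps_of_poly g * fps_of_poly P')) k =
          fps_nth (inverse (fps_of_poly g) * (fps_of_poly g * (fps_of_poly Q' * ?A))) k"
        by (rule fps_mult_nth_cong[OF _ that])
          (use eq in \<open>simp add: P' Q' fps_of_poly_mult[symmetric] mult.assoc[symmetric] del: fps_of_poly_mult\<close>)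
      then show ?thesis unfolding inv by simp
    qed
    have dQ: "degree Q' + 1 \<le> q"
      using Q(1) dg ne by (simp add: Q' degree_mult_eq)
    have P'0: "coeff P' k = 0" if "k \<ge> p" for k
    proof (cases "P' = 0")
      case False
      then have "degree P' < p" using P dg ne(1) by (simp add: P' degree_mult_eq)
      then show ?thesis using that by (simp add: coeff_eq_0)
    qed simp
    \<comment> \<open>The factor \<open>X\<close> supplies the zero constant term and moves the
      orders to be checked to \<open>p, ..., p + q - 1\<close>. The first of them is covered because
      cancelling \<open>g\<close> leaves \<open>P'\<close> with degree below \<open>p\<close>; the
      drop in the degree of \<open>Q'\<close> makes room for \<open>X\<close>.\<close>
    have "pCons 0 Q' = 0"
    proof (rule hankel_det_nonzero_imp_eq_0[OF det])
      show "degree (pCons 0 Q') \<le> q" using dQ ne(2) by simp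
      fix k assume k: "p < k" "k \<le> p + q"
      have X: "fps_of_poly (pCons 0 Q') * ?A = fps_X * (fps_of_poly Q' * ?A)"
        by (simp add: fps_of_poly_pCons mult_ac)
      have "fps_nth (fps_of_poly (pCons 0 Q') * ?A) k = fps_nth (fps_of_poly Q' * ?A) (k - 1)"
        unfolding X using k by simp
      also have "\<dots> = 0" using eq'[of "k - 1"] P'0[of "k - 1"] k by simp
      finally show "fps_nth (fps_of_poly (pCons 0 Q') * ?A) k = 0" .
    qed simp
    then show False using ne(2) by simp
  qed
qed

text \<open>Both denominators have constant coefficient 1, so their difference solves the
  homogeneous Hankel system and vanishes; the numerators are then determined by the product.\<close>

lemma is_pade_unique:
  assumes det: "hankel_det a p q \<noteq> 0" and "is_pade a \<zeta> p q R" "is_pade a \<zeta> p q R'"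
  shows "R = R'"
proof -
  obtain P Q P' Q' where R: "R = (P, Q)" "R' = (P', Q')" by (cases R, cases R') auto
  have 1: "degree P \<le> p" "degree Q \<le> q" "coeff Q 0 = 1"
    "\<And>k. k \<le> p + q \<Longrightarrow> coeff P k = fps_nth (fps_of_poly Q * Abs_fps a) k"
    and 2: "degree P' \<le> p" "degree Q' \<le> q" "coeff Q' 0 = 1"
    "\<And>k. k \<le> p + q \<Longrightarrow> coeff P' k = fps_nth (fps_of_poly Q' * Abs_fps a) k"
    using assms(2,3) unfolding R is_pade_iff by auto
  have "Q - Q' = 0"
  proof (rule hankel_det_nonzero_imp_eq_0[OF det])
    show "degree (Q - Q') \<le> q" using 1(2) 2(2) by (rule degree_diff_le)
    fix k assume k: "p < k" "k \<le> p + q"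
    have "coeff P k = 0" "coeff P' k = 0" using k 1(1) 2(1) by (auto simp: coeff_eq_0)
    then show "fps_nth (fps_of_poly (Q - Q') * Abs_fps a) k = 0"
      using 1(4)[OF k(2)] 2(4)[OF k(2)] by (simp add: fps_of_poly_diff left_diff_distrib)
  qed (simp add: 1 2)
  then have Q: "Q = Q'" by simp
  have "coeff P k = coeff P' k" for k
    using 1(1) 1(4)[of k] 2(1) 2(4)[of k] Q by (cases "k \<le> p + q") (auto simp: coeff_eq_0)
  then show ?thesis using Q R by (simp add: poly_eq_iff)
qed

lemma is_pade_pade_num_den:
  assumes "hankel_det a p q \<noteq> 0"
  shows "is_pade a \<zeta> p q (pade_num a p q, pade_den a p q)"
  unfolding is_pade_iff
  using pade_den_props pade_den_num_eq[OF assms] coprime_of_hankel_det_nonzero[OF assms] by blast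

lemma pade_eq:
  assumes "hankel_det (taylor_coeff \<Omega> f \<zeta>) p q \<noteq> 0" "is_pade (taylor_coeff \<Omega> f \<zeta>) \<zeta> p q R"
  shows "pade \<Omega> f \<zeta> p q = R"
  unfolding pade_def using assms is_pade_unique by (blast intro: the_equality)

lemma hankel_det_poly:
  assumes P: "degree P = p" "P \<noteq> 0"
  shows "hankel_det (coeff P) p q \<noteq> 0"
proof
  assume "hankel_det (coeff P) p q = 0"
  then obtain x where x: "x \<in> carrier_vec q" "x \<noteq> 0\<^sub>v q" "hankel_mat (coeff P) p q *\<^sub>v x = 0\<^sub>v q"
    using det_0_iff_vec_prod_zero[OF hankel_mat_carrier[of "coeff P" p q]] unfolding hankel_det_eq by auto
  \<comment> \<open>A kernel vector becomes a polynomial with zero constant term; being in the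
    kernel means that \<open>M * P\<close> has no coefficients at the orders
    \<open>p + 1, ..., p + q\<close>.\<close>
  define M where "M = (\<Sum>v\<le>q. monom (if v = 0 then 0 else x $ (q - v)) v)"
  have M: "degree M \<le> q" "coeff M 0 = 0" by (simp_all add: M_def degree_sum_monom coeff_sum_monom)
  have MP: "fps_of_poly M * Abs_fps (coeff P) = fps_of_poly (M * P)"
    unfolding fps_of_poly_mult by (simp add: fps_of_poly_def)
  have "coeff (M * P) k = 0" if k: "p < k" "k \<le> p + q" for k
  proof -
    define i where "i = k - p - 1"
    have i: "i < q" "k = p + i + 1" using k by (auto simp: i_def)
    have "0 = (hankel_mat (coeff P) p q *\<^sub>v x) $ i" using x(3) i(1) by simp
    also have "\<dots> = (\<Sum>j<q. hankel_mat (coeff P) p q $$ (i, j) * x $ j)"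
      using i x(1) carrier_matD[OF hankel_mat_carrier[of "coeff P" p q]]
      by (simp add: scalar_prod_def atLeast0LessThan)
    also have "\<dots> = (\<Sum>j<q. hankel_mat (coeff P) p q $$ (i, j) * coeff M (q - j))"
      by (intro sum.cong) (auto simp: M_def coeff_sum_monom)
    also have "\<dots> = coeff (M * P) k"
      unfolding hankel_row[OF M(1) i(1)] MP M(2) i(2)[symmetric] by simp
    finally show ?thesis by simp
  qed
  moreover have "M \<noteq> 0"
  proof
    assume "M = 0"
    have "x $ j = 0" if "j < q" for j
    proof -
      have "coeff M (q - j) = x $ j" using that by (simp add: M_def coeff_sum_monom)
      then show ?thesis using \<open>M = 0\<close> by simp
    qed
    then have "x = 0\<^sub>v q" using x(1) by (intro eq_vecI) auto
    then show False using x(2) by simp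
  qed
  moreover from this have "degree M > 0"
    using M(2) leading_coeff_0_iff[of M] by (cases "degree M") auto
  \<comment> \<open>The order \<open>degree M + p\<close> lies in this range since
    \<open>0 < degree M \<le> q\<close>, yet the coefficient there is the product of two nonzero
    leading coefficients.\<close>
  ultimately have "coeff (M * P) (degree M + p) = 0" using M(1) by simp
  then show False using P(2) \<open>M \<noteq> 0\<close> by (simp add: P(1)[symmetric] coeff_mult_degree_sum)
qed

section \<open>Continuity of Pade approximants\<close>

lemma tendsto_det:
  fixes A :: "'x \<Rightarrow> complex mat"
  assumes A: "\<And>x. A x \<in> carrier_mat n n" and B: "B \<in> carrier_mat n n"
    and lim: "\<And>i j. i < n \<Longrightarrow> j < n \<Longrightarrow> ((\<lambda>x. A x $$ (i, j)) \<longlongrightarrow> B $$ (i, j)) F"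
  shows "((\<lambda>x. Determinant.det (A x)) \<longlongrightarrow> Determinant.det B) F"
  unfolding det_def'[OF A] det_def'[OF B]
proof (intro tendsto_sum tendsto_mult tendsto_const tendsto_prod lim)
  fix p i assume p: "p \<in> {p. p permutes {0..<n}}" and i: "i \<in> {0..<n}"
  then show "i < n" by simp
  show "p i < n" using permutes_in_image[of p "{0..<n}" i] p i by simp
qed

lemma tendsto_adj_mat:
  fixes A :: "'x \<Rightarrow> complex mat"
  assumes A: "\<And>x. A x \<in> carrier_mat n n" and B: "B \<in> carrier_mat n n"
    and lim: "\<And>i j. i < n \<Longrightarrow> j < n \<Longrightarrow> ((\<lambda>x. A x $$ (i, j)) \<longlongrightarrow> B $$ (i, j)) F"
    and ij: "i < n" "j < n"
  shows "((\<lambda>x. adj_mat (A x) $$ (i, j)) \<longlongrightarrow> adj_mat B $$ (i, j)) F"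
proof -
  have adj: "adj_mat M $$ (i, j) = (- 1) ^ (j + i) * Determinant.det (mat_delete M j i)"
    if "M \<in> carrier_mat n n" for M :: "complex mat"
    using that ij by (simp add: adj_mat_def cofactor_def)
  have del: "mat_delete M j i $$ (k, l) =
      M $$ (if k < j then k else Suc k, if l < i then l else Suc l)"
    if "M \<in> carrier_mat n n" "k < n - 1" "l < n - 1" for M :: "complex mat" and k l
    using that by (simp add: mat_delete_def)
  have "((\<lambda>x. Determinant.det (mat_delete (A x) j i)) \<longlongrightarrow> Determinant.det (mat_delete B j i)) F"
  proof (rule tendsto_det)
    fix k l assume "k < n - 1" "l < n - 1"
    then show "((\<lambda>x. mat_delete (A x) j i $$ (k, l)) \<longlongrightarrow> mat_delete B j i $$ (k, l)) F"
      unfolding del[OF A \<open>k < n - 1\<close> \<open>l < n - 1\<close>] del[OF B \<open>k < n - 1\<close> \<open>l < n - 1\<close>]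
      by (intro lim) auto
  qed (use mat_delete_carrier[OF A] mat_delete_carrier[OF B] in simp_all)
  then show ?thesis
    unfolding adj[OF A] adj[OF B] by (intro tendsto_mult tendsto_const)
qed

text \<open>Convergence along an arbitrary filter is the form of continuity needed: it will be used
  for functions \<open>g\<close> near \<open>f\<close> with the filter
  \<open>nhdsin (A_infty_top \<Omega>) f\<close>.\<close>

context
  fixes a :: "'x \<Rightarrow> nat \<Rightarrow> complex" and b :: "nat \<Rightarrow> complex" and F :: "'x filter"
  assumes lim: "\<And>v. ((\<lambda>x. a x v) \<longlongrightarrow> b v) F"
begin

lemma tendsto_hankel_mat:
  assumes "i < q" "j < q"
  shows "((\<lambda>x. hankel_mat (a x) p q $$ (i, j)) \<longlongrightarrow> hankel_mat b p q $$ (i, j)) F"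
  using assms by (simp add: hankel_mat_def Let_def lim)

lemma tendsto_hankel_det: "((\<lambda>x. hankel_det (a x) p q) \<longlongrightarrow> hankel_det b p q) F"
  unfolding hankel_det_eq by (rule tendsto_det[of _ q]) (simp_all add: tendsto_hankel_mat)

lemma tendsto_coeff_pade_den:
  assumes "hankel_det b p q \<noteq> 0"
  shows "((\<lambda>x. coeff (pade_den (a x) p q) v) \<longlongrightarrow> coeff (pade_den b p q) v) F"
proof (cases "v = 0 \<or> v > q")
  case True
  then show ?thesis by (auto simp: pade_den_def coeff_sum_monom)
next
  case False
  have "((\<lambda>x. (\<Sum>k<q. adj_mat (hankel_mat (a x) p q) $$ (q - v, k) * (- a x (p + k + 1))) / hankel_det (a x) p q)
      \<longlongrightarrow> (\<Sum>k<q. adj_mat (hankel_mat b p q) $$ (q - v, k) * (- b (p + k + 1))) / hankel_det b p q) F"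
    using False assms
    by (intro tendsto_divide tendsto_sum tendsto_mult tendsto_minus lim tendsto_hankel_det
        tendsto_adj_mat[of _ q] hankel_mat_carrier tendsto_hankel_mat) auto
  then show ?thesis using False by (simp add: pade_den_def coeff_sum_monom)
qed

lemma tendsto_coeff_pade_num:
  assumes "hankel_det b p q \<noteq> 0"
  shows "((\<lambda>x. coeff (pade_num (a x) p q) v) \<longlongrightarrow> coeff (pade_num b p q) v) F"
  by (cases "v \<le> p")
    (simp_all add: pade_num_def coeff_sum_monom fps_mult_nth tendsto_sum tendsto_mult lim
      tendsto_coeff_pade_den[OF assms])

end

lemma uniform_limit_poly:
  fixes P :: "'x \<Rightarrow> complex poly"
  assumes K: "bounded K" and deg: "\<And>x. degree (P x) \<le> n" "degree Q \<le> n"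
    and lim: "\<And>i. ((\<lambda>x. coeff (P x) i) \<longlongrightarrow> coeff Q i) F"
  shows "uniform_limit K (\<lambda>x. poly (P x)) (poly Q) F"
proof (rule uniform_limitI)
  fix e :: real assume "e > 0"
  obtain B where B: "\<And>z. z \<in> K \<Longrightarrow> cmod z \<le> B" using K by (auto simp: bounded_iff)
  have "((\<lambda>x. \<Sum>i\<le>n. cmod (coeff (P x) i - coeff Q i) * B ^ i) \<longlongrightarrow>
      (\<Sum>i\<le>n. cmod (coeff Q i - coeff Q i) * B ^ i)) F"
    by (intro tendsto_intros lim)
  then have "\<forall>\<^sub>F x in F. (\<Sum>i\<le>n. cmod (coeff (P x) i - coeff Q i) * B ^ i) < e"
    using \<open>e > 0\<close> by (intro order_tendstoD(2)) auto
  then show "\<forall>\<^sub>F x in F. \<forall>z\<in>K. dist (poly (P x) z) (poly Q z) < e"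
  proof eventually_elim
    case (elim x)
    show ?case
    proof
      fix z assume z: "z \<in> K"
      have p: "poly R z = (\<Sum>i\<le>n. coeff R i * z ^ i)" if "degree R \<le> n" for R
        by (subst poly_as_sum_of_monoms'[OF that, symmetric]) (simp add: poly_sum poly_monom)
      have "dist (poly (P x) z) (poly Q z) = cmod (\<Sum>i\<le>n. (coeff (P x) i - coeff Q i) * z ^ i)"
        unfolding dist_norm p[OF deg(1)] p[OF deg(2)] by (simp add: sum_subtractf left_diff_distrib)
      also have "\<dots> \<le> (\<Sum>i\<le>n. cmod (coeff (P x) i - coeff Q i) * B ^ i)"
        by (intro sum_norm_le) (auto simp: norm_mult norm_power intro!: mult_left_mono power_mono B[OF z])
      finally show "dist (poly (P x) z) (poly Q z) < e" using elim by simp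
    qed
  qed
qed

lemma uniform_limit_compose_arg:
  "uniform_limit (h ` K) f g F \<Longrightarrow> uniform_limit K (\<lambda>x z. f x (h z)) (\<lambda>z. g (h z)) F"
  by (simp add: uniform_limit_iff)

lemma uniform_limit_higher_deriv:
  assumes r: "r > 0" and lim: "uniform_limit (\<Union>x\<in>K. cball x r) f g F"
    and f: "\<forall>\<^sub>F x in F. f x holomorphic_on (\<Union>x\<in>K. cball x r)"
    and g: "g holomorphic_on (\<Union>x\<in>K. cball x r)"
  shows "uniform_limit K (\<lambda>x. (deriv ^^ l) (f x)) ((deriv ^^ l) g) F"
proof (rule uniform_limitI)
  fix e :: real assume "e > 0"
  define d where "d = e * r ^ l / (2 * fact l)"
  have d: "d > 0" "fact l * d / r ^ l < e" using \<open>e > 0\<close> r by (simp_all add: d_def)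
  show "\<forall>\<^sub>F x in F. \<forall>z\<in>K. dist ((deriv ^^ l) (f x) z) ((deriv ^^ l) g z) < e"
    using uniform_limitD[OF lim d(1)] f
  proof eventually_elim
    case (elim x)
    show ?case
    proof
      fix z assume z: "z \<in> K"
      have sub: "cball z r \<subseteq> (\<Union>x\<in>K. cball x r)" using z by blast
      have hol: "f x holomorphic_on cball z r" "g holomorphic_on cball z r"
        using elim(2) g sub by (blast intro: holomorphic_on_subset)+
      have "(deriv ^^ l) (f x) z - (deriv ^^ l) g z = (deriv ^^ l) (\<lambda>w. f x w - g w) z"
        by (rule higher_deriv_diff[symmetric, of _ "ball z r"])
          (use hol r in \<open>auto intro: holomorphic_on_subset\<close>)
      also have "cmod \<dots> \<le> fact l * d / r ^ l"
      proof (rule higher_deriv_bound[OF _ _ r])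
        show "(\<lambda>w. f x w - g w) holomorphic_on cball z r" by (intro holomorphic_on_diff hol)
        show "cmod (f x w - g w) < d" if "w \<in> cball z r" for w
          using elim(1) sub that by (auto simp: dist_norm)
      qed
      finally show "dist ((deriv ^^ l) (f x) z) ((deriv ^^ l) g z) < e"
        using d(2) by (simp add: dist_norm)
    qed
  qed
qed

text \<open>A denominator without zeros on \<open>K\<close> is bounded away from 0 on a compact
  neighbourhood \<open>N\<close>, so denominators with nearby coefficients have no zeros there
  either. Quotients then converge uniformly on \<open>N\<close>, and Cauchy's estimate passes this
  to derivatives on \<open>K\<close>.\<close>

lemma uniform_limit_higher_deriv_ratfun:
  assumes K: "compact K" and degP: "\<And>x. degree (P x) \<le> p" "degree P' \<le> p"
    and degQ: "\<And>x. degree (Q x) \<le> q" "degree Q' \<le> q"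
    and limP: "\<And>i. ((\<lambda>x. coeff (P x) i) \<longlongrightarrow> coeff P' i) F"
    and limQ: "\<And>i. ((\<lambda>x. coeff (Q x) i) \<longlongrightarrow> coeff Q' i) F"
    and nz: "\<And>z. z \<in> K \<Longrightarrow> poly Q' (z - \<zeta>) \<noteq> 0"
  shows "uniform_limit K (\<lambda>x. (deriv ^^ l) (ratfun \<zeta> (P x, Q x))) ((deriv ^^ l) (ratfun \<zeta> (P', Q'))) F"
    and "\<forall>\<^sub>F x in F. \<forall>z\<in>K. poly (Q x) (z - \<zeta>) \<noteq> 0"
proof -
  have "open {z. poly Q' (z - \<zeta>) \<noteq> 0}" by (intro open_Collect_neq continuous_intros)
  moreover have "K \<subseteq> {z. poly Q' (z - \<zeta>) \<noteq> 0}" using nz by auto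
  ultimately obtain r where r: "r > 0" "(\<Union>x\<in>K. cball x r) \<subseteq> {z. poly Q' (z - \<zeta>) \<noteq> 0}"
    using compact_subset_open_imp_cball_epsilon_subset[OF K] by blast
  define N where "N = (\<Union>x\<in>K. cball x r)"
  have N: "compact N" "\<And>z. z \<in> N \<Longrightarrow> poly Q' (z - \<zeta>) \<noteq> 0"
    using r(2) compact_minkowski_sum_cball[OF K] unfolding N_def by blast+
  have "K \<subseteq> N" using r(1) unfolding N_def by force
  obtain c where c: "c > 0" "\<And>z. z \<in> N \<Longrightarrow> c \<le> cmod (poly Q' (z - \<zeta>))"
  proof (cases "N = {}")
    case True
    then show ?thesis using that[of 1] by simp
  next
    case False
    have "continuous_on N (\<lambda>z. cmod (poly Q' (z - \<zeta>)))" by (intro continuous_intros)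
    then obtain w where "w \<in> N" "\<forall>z\<in>N. cmod (poly Q' (w - \<zeta>)) \<le> cmod (poly Q' (z - \<zeta>))"
      using continuous_attains_inf[OF N(1) False] by blast
    then show ?thesis using that[of "cmod (poly Q' (w - \<zeta>))"] N(2) by simp
  qed
  have bd: "bounded ((\<lambda>z. z - \<zeta>) ` N)"
    by (intro compact_imp_bounded compact_continuous_image N(1) continuous_intros)
  have ulQ: "uniform_limit N (\<lambda>x z. poly (Q x) (z - \<zeta>)) (\<lambda>z. poly Q' (z - \<zeta>)) F"
    by (rule uniform_limit_compose_arg[OF uniform_limit_poly[OF bd degQ limQ]])
  have ulP: "uniform_limit N (\<lambda>x z. poly (P x) (z - \<zeta>)) (\<lambda>z. poly P' (z - \<zeta>)) F"
    by (rule uniform_limit_compose_arg[OF uniform_limit_poly[OF bd degP limP]])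
  have nzN: "\<forall>\<^sub>F x in F. \<forall>z\<in>N. poly (Q x) (z - \<zeta>) \<noteq> 0"
    using uniform_limitD[OF ulQ c(1)]
  proof eventually_elim
    case (elim x)
    show ?case
    proof
      fix z assume z: "z \<in> N"
      show "poly (Q x) (z - \<zeta>) \<noteq> 0"
        using elim[rule_format, OF z] c(2)[OF z] by (auto simp: dist_norm)
    qed
  qed
  then show "\<forall>\<^sub>F x in F. \<forall>z\<in>K. poly (Q x) (z - \<zeta>) \<noteq> 0"
    by eventually_elim (use \<open>K \<subseteq> N\<close> in blast)
  have ul: "uniform_limit N (\<lambda>x. ratfun \<zeta> (P x, Q x)) (ratfun \<zeta> (P', Q')) F"
    unfolding ratfun_def fst_conv snd_conv
    by (rule uniform_lim_divide[OF ulP ulQ _ c(2) c(1)])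
      (auto intro!: compact_imp_bounded compact_continuous_image N(1) continuous_intros)
  have hol: "ratfun \<zeta> (A, B) holomorphic_on N" if "\<forall>z\<in>N. poly B (z - \<zeta>) \<noteq> 0" for A B
    unfolding ratfun_def fst_conv snd_conv using that by (intro holomorphic_intros) auto
  show "uniform_limit K (\<lambda>x. (deriv ^^ l) (ratfun \<zeta> (P x, Q x))) ((deriv ^^ l) (ratfun \<zeta> (P', Q'))) F"
  proof (rule uniform_limit_higher_deriv[OF r(1), where K = K, folded N_def, OF ul])
    show "\<forall>\<^sub>F x in F. ratfun \<zeta> (P x, Q x) holomorphic_on N"
      using nzN by eventually_elim (rule hol)
    show "ratfun \<zeta> (P', Q') holomorphic_on N" using N(2) by (intro hol) blast
  qed
qed

section \<open>Open conditions that characterise approximable functions\<close>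

lemma uniform_limit_nhdsin_A_infty:
  assumes f: "f \<in> A_infty \<Omega>" and K: "compact K" "K \<subseteq> closure \<Omega>"
  shows "uniform_limit K (ext_deriv \<Omega> l) (ext_deriv \<Omega> l f) (nhdsin (A_infty_top \<Omega>) f)"
proof (rule uniform_limitI)
  fix e :: real assume e: "e > 0"
  have "openin (A_infty_top \<Omega>) (A_infty_ball \<Omega> l K f e)"
    unfolding A_infty_top_def using K e f by (intro topology_generated_by_Basis) blast
  moreover have "f \<in> A_infty_ball \<Omega> l K f e" using f e by (simp add: A_infty_ball_def)
  ultimately show "\<forall>\<^sub>F g in nhdsin (A_infty_top \<Omega>) f. \<forall>z\<in>K. dist (ext_deriv \<Omega> l g z) (ext_deriv \<Omega> l f z) < e"
    unfolding eventually_nhdsin by (auto simp: A_infty_ball_def dist_norm)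
qed

text \<open>The bound is put on the supremum and is strict, which leaves slack for openness; being
  finite, it also excludes poles in the truncated closure.\<close>

definition pade_close :: "complex set \<Rightarrow> complex \<Rightarrow> nat \<Rightarrow> nat \<Rightarrow> nat \<Rightarrow> (complex \<Rightarrow> complex) set" where
  "pade_close \<Omega> \<zeta> p q j = {f \<in> D_class \<Omega> \<zeta> p q.
     \<forall>l\<le>j. (SUP z\<in>closure \<Omega> \<inter> cball 0 (real j). pade_error \<Omega> f \<zeta> p q l z) < ennreal (1 / Suc j)}"

lemma eventually_SUP_pade_error_less:
  assumes \<zeta>: "\<zeta> \<in> closure \<Omega>" and K: "compact K" "K \<subseteq> closure \<Omega>"
    and f: "f \<in> D_class \<Omega> \<zeta> p q" and less: "(SUP z\<in>K. pade_error \<Omega> f \<zeta> p q l z) < ennreal c"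
  shows "\<forall>\<^sub>F g in nhdsin (A_infty_top \<Omega>) f.
    g \<in> D_class \<Omega> \<zeta> p q \<and> (SUP z\<in>K. pade_error \<Omega> g \<zeta> p q l z) < ennreal c"
proof -
  let ?F = "nhdsin (A_infty_top \<Omega>) f"
  define a where "a g = taylor_coeff \<Omega> g \<zeta>" for g
  have fA: "f \<in> A_infty \<Omega>" and det: "hankel_det (a f) p q \<noteq> 0"
    using f by (auto simp: D_class_def a_def)
  have pade: "pade \<Omega> g \<zeta> p q = (pade_num (a g) p q, pade_den (a g) p q)"
    if "hankel_det (a g) p q \<noteq> 0" for g
    using that unfolding a_def by (intro pade_eq is_pade_pade_num_den)
  have lim: "((\<lambda>g. a g v) \<longlongrightarrow> a f v) ?F" for v
  proof -
    have e: "((\<lambda>g. ext_deriv \<Omega> v g \<zeta>) \<longlongrightarrow> ext_deriv \<Omega> v f \<zeta>) ?F"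
      by (rule tendsto_uniform_limitI[OF uniform_limit_nhdsin_A_infty[OF fA, of "{\<zeta>}"]]) (use \<zeta> in auto)
    show ?thesis unfolding a_def taylor_coeff_def by (intro tendsto_divide e tendsto_const) simp
  qed
  define S where "S = (SUP z\<in>K. pade_error \<Omega> f \<zeta> p q l z)"
  have S_top: "S < \<infinity>" unfolding S_def infinity_ennreal_def by (rule order.strict_trans[OF less ennreal_less_top])
  have nz: "poly (pade_den (a f) p q) (z - \<zeta>) \<noteq> 0" if "z \<in> K" for z
  proof
    assume "poly (pade_den (a f) p q) (z - \<zeta>) = 0"
    then have "pade_error \<Omega> f \<zeta> p q l z = \<infinity>" by (simp add: pade_error_def pade[OF det])
    moreover have "pade_error \<Omega> f \<zeta> p q l z \<le> S" unfolding S_def by (rule SUP_upper[OF that])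
    ultimately show False using S_top by (simp add: top_unique)
  qed
  obtain s where s: "S = ennreal s" "s \<ge> 0" using S_top by (cases S) auto
  have sc: "s < c" using less s by (simp add: S_def[symmetric] ennreal_less_iff)
  \<comment> \<open>Half of the slack between the error of \<open>f\<close> and \<open>c\<close>. It
    is shared equally between the change of the approximant and the change of the function when
    \<open>f\<close> is replaced by \<open>g\<close>.\<close>
  define \<eta> where "\<eta> = (c - s) / 2"
  have \<eta>: "\<eta> > 0" "s + \<eta> < c" using sc by (simp_all add: \<eta>_def field_simps)
  note rat = uniform_limit_higher_deriv_ratfun[OF K(1) pade_den_props(3) pade_den_props(3)
      pade_den_props(1) pade_den_props(1) tendsto_coeff_pade_num[OF lim det] tendsto_coeff_pade_den[OF lim det]]
  have rat1: "uniform_limit K (\<lambda>g. (deriv ^^ l) (ratfun \<zeta> (pade_num (a g) p q, pade_den (a g) p q)))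
      ((deriv ^^ l) (ratfun \<zeta> (pade_num (a f) p q, pade_den (a f) p q))) ?F"
    by (rule rat(1)) (rule nz)
  have rat2: "\<forall>\<^sub>F g in ?F. \<forall>z\<in>K. poly (pade_den (a g) p q) (z - \<zeta>) \<noteq> 0"
    by (rule rat(2)) (rule nz)
  have A: "\<forall>\<^sub>F g in ?F. g \<in> A_infty \<Omega>"
    unfolding eventually_nhdsin topspace_A_infty_top
    using fA openin_topspace[of "A_infty_top \<Omega>"] by (auto simp: topspace_A_infty_top)
  have D: "\<forall>\<^sub>F g in ?F. hankel_det (a g) p q \<noteq> 0"
    by (rule tendsto_imp_eventually_ne[OF tendsto_hankel_det[OF lim] det])
  have e2: "\<eta> / 2 > 0" using \<eta> by simp
  show ?thesis
    using A D rat2 uniform_limitD[OF rat1 e2]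
      uniform_limitD[OF uniform_limit_nhdsin_A_infty[OF fA K, of l] e2]
  proof eventually_elim
    case (elim g)
    have "pade_error \<Omega> g \<zeta> p q l z \<le> S + ennreal \<eta>" if z: "z \<in> K" for z
    proof -
      let ?R = "\<lambda>h. (deriv ^^ l) (ratfun \<zeta> (pade_num (a h) p q, pade_den (a h) p q)) z"
      have f': "pade_error \<Omega> f \<zeta> p q l z = ennreal (cmod (?R f - ext_deriv \<Omega> l f z))"
        using nz[OF z] by (simp add: pade_error_def pade[OF det])
      have g': "pade_error \<Omega> g \<zeta> p q l z = ennreal (cmod (?R g - ext_deriv \<Omega> l g z))"
        using elim(3)[rule_format, OF z] by (simp add: pade_error_def pade[OF elim(2)])
      have e4: "cmod (?R g - ?R f) \<le> \<eta> / 2"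
        using elim(4)[rule_format, OF z] by (simp add: dist_norm)
      have e5: "cmod (ext_deriv \<Omega> l f z - ext_deriv \<Omega> l g z) \<le> \<eta> / 2"
        using elim(5)[rule_format, OF z] by (simp add: dist_norm norm_minus_commute)
      have tri: "cmod (u + (v + w)) \<le> cmod u + \<eta>" if "cmod v \<le> \<eta> / 2" "cmod w \<le> \<eta> / 2" for u v w :: complex
        using that norm_triangle_ineq[of u "v + w"] norm_triangle_ineq[of v w] by linarith
      have eq: "(?R f - ext_deriv \<Omega> l f z) + ((?R g - ?R f) + (ext_deriv \<Omega> l f z - ext_deriv \<Omega> l g z)) =
          ?R g - ext_deriv \<Omega> l g z"
        by simp
      have "cmod (?R g - ext_deriv \<Omega> l g z) \<le> cmod (?R f - ext_deriv \<Omega> l f z) + \<eta>"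
        by (rule tri[OF e4 e5, of "?R f - ext_deriv \<Omega> l f z", unfolded eq])
      then have "pade_error \<Omega> g \<zeta> p q l z \<le> ennreal (cmod (?R f - ext_deriv \<Omega> l f z) + \<eta>)"
        unfolding g' by (rule ennreal_leI)
      also have "\<dots> = pade_error \<Omega> f \<zeta> p q l z + ennreal \<eta>"
        unfolding f' using \<eta> by (simp add: ennreal_plus)
      also have "\<dots> \<le> S + ennreal \<eta>"
        unfolding S_def by (intro add_right_mono SUP_upper z)
      finally show ?thesis .
    qed
    then have "(SUP z\<in>K. pade_error \<Omega> g \<zeta> p q l z) \<le> S + ennreal \<eta>" by (rule SUP_least)
    also have "\<dots> = ennreal (s + \<eta>)" using s \<eta> by (simp add: ennreal_plus)
    also have "\<dots> < ennreal c" by (rule ennreal_lessI) (use \<eta> s in linarith)+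
    finally show ?case using elim(1,2) by (simp add: D_class_def a_def)
  qed
qed

lemma openin_pade_close:
  assumes \<zeta>: "\<zeta> \<in> closure \<Omega>"
  shows "openin (A_infty_top \<Omega>) (pade_close \<Omega> \<zeta> p q j)"
  unfolding openin_subopen[of _ "pade_close \<Omega> \<zeta> p q j"]
proof
  fix f assume f: "f \<in> pade_close \<Omega> \<zeta> p q j"
  have K: "compact (closure \<Omega> \<inter> cball 0 (real j))" by (simp add: closed_Int_compact)
  have "\<forall>\<^sub>F g in nhdsin (A_infty_top \<Omega>) f. \<forall>l\<in>{..j}. g \<in> D_class \<Omega> \<zeta> p q \<and>
      (SUP z\<in>closure \<Omega> \<inter> cball 0 (real j). pade_error \<Omega> g \<zeta> p q l z) < ennreal (1 / Suc j)"
    using f unfolding pade_close_def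
    by (intro eventually_ball_finite ballI eventually_SUP_pade_error_less[OF \<zeta> K]) auto
  then have "\<forall>\<^sub>F g in nhdsin (A_infty_top \<Omega>) f. g \<in> pade_close \<Omega> \<zeta> p q j"
    by eventually_elim (auto simp: pade_close_def)
  moreover have "f \<in> topspace (A_infty_top \<Omega>)"
    using f by (simp add: topspace_A_infty_top pade_close_def D_class_def)
  ultimately show "\<exists>T. openin (A_infty_top \<Omega>) T \<and> f \<in> T \<and> T \<subseteq> pade_close \<Omega> \<zeta> p q j"
    unfolding eventually_nhdsin by blast
qed

text \<open>Diagonal choice: the pair found for \<open>j = n\<close> is the \<open>n\<close>-th term
  of the sequence. It serves a compact \<open>K \<subseteq> cball 0 m\<close> and an order
  \<open>l\<close> as soon as \<open>n \<ge> max m l\<close>, so one sequence works for all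
  \<open>K\<close> and \<open>l\<close>.\<close>

lemma pade_approximable_iff:
  "pade_approximable \<Omega> \<zeta> \<F> f \<longleftrightarrow> (\<forall>j. \<exists>(p, q)\<in>\<F>. f \<in> pade_close \<Omega> \<zeta> p q j)"
proof
  assume "pade_approximable \<Omega> \<zeta> \<F> f"
  then obtain p q :: "nat \<Rightarrow> nat" where pq: "\<forall>n. (p n, q n) \<in> \<F>"
    "\<forall>K. compact K \<and> K \<subseteq> closure \<Omega> \<longrightarrow> (\<forall>n. f \<in> D_class \<Omega> \<zeta> (p n) (q n)) \<and>
       (\<forall>l. (\<lambda>n. SUP z\<in>K. pade_error \<Omega> f \<zeta> (p n) (q n) l z) \<longlonglongrightarrow> 0)"
    unfolding pade_approximable_def by (elim exE conjE) (rule that)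
  show "\<forall>j. \<exists>(p, q)\<in>\<F>. f \<in> pade_close \<Omega> \<zeta> p q j"
  proof
    fix j
    have K: "compact (closure \<Omega> \<inter> cball 0 (real j))" "closure \<Omega> \<inter> cball 0 (real j) \<subseteq> closure \<Omega>"
      by (simp_all add: closed_Int_compact)
    have pqK: "(\<forall>n. f \<in> D_class \<Omega> \<zeta> (p n) (q n)) \<and>
       (\<forall>l. (\<lambda>n. SUP z\<in>closure \<Omega> \<inter> cball 0 (real j). pade_error \<Omega> f \<zeta> (p n) (q n) l z) \<longlonglongrightarrow> 0)"
      by (rule pq(2)[rule_format]) (use K in blast)
    have "\<forall>\<^sub>F n in sequentially. \<forall>l\<in>{..j}.
        (SUP z\<in>closure \<Omega> \<inter> cball 0 (real j). pade_error \<Omega> f \<zeta> (p n) (q n) l z) < ennreal (1 / Suc j)"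
      using pqK by (intro eventually_ball_finite ballI order_tendstoD(2)) auto
    then obtain n where "\<forall>l\<in>{..j}.
        (SUP z\<in>closure \<Omega> \<inter> cball 0 (real j). pade_error \<Omega> f \<zeta> (p n) (q n) l z) < ennreal (1 / Suc j)"
      by (auto simp: eventually_sequentially)
    then have "f \<in> pade_close \<Omega> \<zeta> (p n) (q n) j"
      using pqK by (auto simp: pade_close_def)
    then show "\<exists>(p, q)\<in>\<F>. f \<in> pade_close \<Omega> \<zeta> p q j" using pq(1) by blast
  qed
next
  assume "\<forall>j. \<exists>(p, q)\<in>\<F>. f \<in> pade_close \<Omega> \<zeta> p q j"
  then have "\<forall>j. \<exists>x. x \<in> \<F> \<and> f \<in> pade_close \<Omega> \<zeta> (fst x) (snd x) j" by fastforce
  then obtain x where x: "\<And>j. x j \<in> \<F>" "\<And>j. f \<in> pade_close \<Omega> \<zeta> (fst (x j)) (snd (x j)) j"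
    by metis
  have "(\<lambda>n. SUP z\<in>K. pade_error \<Omega> f \<zeta> (fst (x n)) (snd (x n)) l z) \<longlonglongrightarrow> 0"
    if K: "compact K" "K \<subseteq> closure \<Omega>" for K l
  proof (rule tendsto_sandwich[OF _ _ tendsto_const])
    have "(\<lambda>n. 1 / real (Suc n)) \<longlonglongrightarrow> 0"
      using LIMSEQ_inverse_real_of_nat by (simp add: inverse_eq_divide)
    then show "(\<lambda>n. ennreal (1 / Suc n)) \<longlonglongrightarrow> 0" using tendsto_ennrealI by fastforce
    obtain m where m: "\<And>z. z \<in> K \<Longrightarrow> cmod z \<le> real m"
      using compact_imp_bounded[OF K(1)] unfolding bounded_iff by (meson order_trans real_arch_simple)
    show "\<forall>\<^sub>F n in sequentially. (SUP z\<in>K. pade_error \<Omega> f \<zeta> (fst (x n)) (snd (x n)) l z) \<le> ennreal (1 / Suc n)"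
      using eventually_ge_at_top[of "max m l"]
    proof eventually_elim
      case (elim n)
      have "real m \<le> real n" using elim by simp
      then have "K \<subseteq> closure \<Omega> \<inter> cball 0 (real n)"
        using K(2) order_trans[OF m] by auto
      then have "(SUP z\<in>K. pade_error \<Omega> f \<zeta> (fst (x n)) (snd (x n)) l z)
          \<le> (SUP z\<in>closure \<Omega> \<inter> cball 0 (real n). pade_error \<Omega> f \<zeta> (fst (x n)) (snd (x n)) l z)"
        by (rule SUP_subset_mono) simp
      also have "\<dots> \<le> ennreal (1 / Suc n)"
        using x(2)[of n] elim by (auto simp: pade_close_def intro: less_imp_le)
      finally show ?case .
    qed
  qed auto
  moreover have "f \<in> D_class \<Omega> \<zeta> (fst (x n)) (snd (x n))" for n
    using x(2)[of n] by (simp add: pade_close_def)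
  ultimately show "pade_approximable \<Omega> \<zeta> \<F> f"
    unfolding pade_approximable_def using x(1)
    by (intro exI[of _ "\<lambda>n. fst (x n)"] exI[of _ "\<lambda>n. snd (x n)"]) simp
qed

section \<open>Density of the polynomials\<close>

text \<open>If the complement splits into two open parts, the connected exterior of the disc lies in
  one of them, \<open>A\<close>. The other part lies in the disc and therefore misses
  \<open>C\<close>; together with \<open>A\<close> enlarged by the point \<open>None\<close> at
  infinity, it would separate the complement of \<open>C\<close> in the sphere.\<close>

lemma connected_Compl_Int_cball:
  fixes C :: "complex set"
  assumes C: "closed C"
    and conn: "connectedin (Alexandroff_compactification (euclidean :: complex topology)) (UNIV - Some ` C)"
  shows "connected (- (C \<inter> cball 0 R))"
proof -
  let ?L = "C \<inter> cball 0 R"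
  have opL: "open (- ?L)" by (intro open_Compl closed_Int C closed_cball)
  have one_sided: "B = {}"
    if AB: "open A" "open B" "A \<inter> B = {}" "A \<union> B = - ?L" and out: "- cball 0 R \<subseteq> A" for A B
  proof (rule ccontr)
    assume "B \<noteq> {}"
    have B: "B \<subseteq> - C" using AB(3,4) out by blast
    have "- A \<subseteq> cball 0 R" using out by blast
    then have cA: "compact (- A)"
      using AB(1) by (meson bounded_cball bounded_subset closed_Compl compact_eq_bounded_closed)
    let ?T = "Alexandroff_compactification (euclidean :: complex topology)"
    have "openin ?T (Some ` B)" using AB(2) by simp
    moreover have "openin ?T (insert None (Some ` A))"
      unfolding openin_Alexandroff_compactification
      using cA AB(1) by (intro disjI2 exI[of _ "- A"]) (auto simp: closed_Compl Compl_eq_Diff_UNIV[symmetric])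
    moreover have "UNIV - Some ` C \<subseteq> Some ` B \<union> insert None (Some ` A)"
    proof
      fix x assume x: "x \<in> UNIV - Some ` C"
      show "x \<in> Some ` B \<union> insert None (Some ` A)"
      proof (cases x)
        case (Some z)
        then have "z \<in> A \<union> B" unfolding AB(4) using x by blast
        then show ?thesis using Some by blast
      qed simp
    qed
    moreover have "Some ` B \<inter> insert None (Some ` A) \<inter> (UNIV - Some ` C) = {}" using AB(3) by blast
    moreover have "Some ` B \<inter> (UNIV - Some ` C) \<noteq> {}" using B \<open>B \<noteq> {}\<close> by blast
    moreover have "insert None (Some ` A) \<inter> (UNIV - Some ` C) \<noteq> {}" by blast
    ultimately show False using connectedinD[OF conn] by metis
  qed
  have D: "connected (- cball (0::complex) R)" by (rule connected_complement_bounded_convex) auto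
  show ?thesis
  proof (rule ccontr)
    assume "\<not> connected (- ?L)"
    then obtain E1 E2 where E: "open E1" "open E2" "- ?L \<subseteq> E1 \<union> E2" "E1 \<inter> E2 \<inter> - ?L = {}"
      "E1 \<inter> - ?L \<noteq> {}" "E2 \<inter> - ?L \<noteq> {}"
      unfolding connected_def not_not by (elim exE conjE) (rule that)
    define A B where "A = E1 \<inter> - ?L" and "B = E2 \<inter> - ?L"
    have op: "open A" "open B" unfolding A_def B_def by (intro open_Int E(1,2) opL)+
    have disj: "A \<inter> B = {}" using E(4) unfolding A_def B_def by blast
    have un: "A \<union> B = - ?L" using E(3) unfolding A_def B_def by blast
    have ne: "A \<noteq> {}" "B \<noteq> {}" using E(5,6) unfolding A_def B_def by simp_all
    have sub: "- cball 0 R \<subseteq> A \<union> B" unfolding un by blast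
    have "A \<inter> - cball 0 R = {} \<or> B \<inter> - cball 0 R = {}"
      by (rule connectedD[OF D op _ sub]) (use disj in blast)
    then have "- cball 0 R \<subseteq> B \<or> - cball 0 R \<subseteq> A" using sub by blast
    then show False
    proof
      assume "- cball 0 R \<subseteq> B"
      moreover have "B \<inter> A = {}" "B \<union> A = - ?L" using disj un by (simp_all only: Int_commute Un_commute)
      ultimately show False using one_sided[OF op(2,1)] ne(1) by simp
    next
      assume "- cball 0 R \<subseteq> A"
      then show False using one_sided[OF op disj un] ne(2) by simp
    qed
  qed
qed

lemma
  assumes \<Omega>: "open \<Omega>" and U: "open U" "closure \<Omega> \<subseteq> U" "h holomorphic_on U"
  shows restrict_in_A_infty: "restrict h \<Omega> \<in> A_infty \<Omega>"
    and ext_deriv_restrict: "z \<in> closure \<Omega> \<Longrightarrow> ext_deriv \<Omega> l (restrict h \<Omega>) z = (deriv ^^ l) h z"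
proof -
  have sub: "\<Omega> \<subseteq> U" using U(2) closure_subset by blast
  have hol: "h holomorphic_on \<Omega>" using U(3) sub by (rule holomorphic_on_subset)
  have hol': "restrict h \<Omega> holomorphic_on \<Omega>"
    using hol by (rule holomorphic_transform) simp
  have eq: "(deriv ^^ l) h w = (deriv ^^ l) (restrict h \<Omega>) w" if "w \<in> \<Omega>" for l w
    by (rule higher_deriv_transform_within_open[OF hol hol' \<Omega> that]) simp
  have cont: "continuous_on (closure \<Omega>) ((deriv ^^ l) h)" for l
    using holomorphic_on_imp_continuous_on[OF holomorphic_higher_deriv[OF U(3,1)]] U(2)
    by (rule continuous_on_subset)
  show "restrict h \<Omega> \<in> A_infty \<Omega>"
    unfolding A_infty_def using hol' cont eq by (intro CollectI conjI allI exI[of _ "(deriv ^^ _) h"]) auto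
  show "ext_deriv \<Omega> l (restrict h \<Omega>) z = (deriv ^^ l) h z" if "z \<in> closure \<Omega>"
    by (rule ext_deriv_eqI[OF cont eq \<Omega> that])
qed

lemma H_closure_subset_A_infty: "open \<Omega> \<Longrightarrow> H_closure \<Omega> \<subseteq> A_infty \<Omega>"
  unfolding H_closure_def using restrict_in_A_infty by blast

lemma entire_in_H_closure: "h holomorphic_on UNIV \<Longrightarrow> restrict h \<Omega> \<in> H_closure \<Omega>"
  unfolding H_closure_def by (intro CollectI exI[of _ h] exI[of _ UNIV]) simp

lemma polynomials_on_subset_H_closure: "polynomials_on \<Omega> \<subseteq> H_closure \<Omega>"
proof -
  have "poly P holomorphic_on UNIV" for P by (rule poly_holomorphic_on[OF holomorphic_on_ident])
  then show ?thesis unfolding polynomials_on_def using entire_in_H_closure by blast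
qed

text \<open>The \<open>m\<close>-th polynomial handles \<open>m\<close> derivatives on the
  \<open>m\<close>-th truncation with error \<open>1 / Suc m\<close>, so a single sequence converges
  for every order and compact set even if \<open>closure \<Omega>\<close> is unbounded.\<close>

lemma H_closure_subset_closure_of_polynomials:
  assumes \<Omega>: "open \<Omega>"
    and conn: "connectedin (Alexandroff_compactification (euclidean :: complex topology))
      (UNIV - Some ` closure \<Omega>)"
  shows "H_closure \<Omega> \<subseteq> A_infty_top \<Omega> closure_of polynomials_on \<Omega>"
proof
  fix f assume "f \<in> H_closure \<Omega>"
  then obtain h U where f: "f = restrict h \<Omega>" and U: "open U" "closure \<Omega> \<subseteq> U" "h holomorphic_on U"
    by (auto simp: H_closure_def)
  define L where "L m = closure \<Omega> \<inter> cball 0 (real m)" for m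
  have "\<exists>P. \<forall>l\<le>m. \<forall>z\<in>L m. cmod ((deriv ^^ l) (poly P) z - (deriv ^^ l) h z) \<le> 1 / Suc m" for m
    using U by (intro Runge_polynomial_derivs[of _ U] connected_Compl_Int_cball[OF _ conn, of m, folded L_def])
      (auto simp: L_def closed_Int_compact)
  then obtain P where P: "\<And>m l z. l \<le> m \<Longrightarrow> z \<in> L m \<Longrightarrow>
      cmod ((deriv ^^ l) (poly (P m)) z - (deriv ^^ l) h z) \<le> 1 / Suc m" by metis
  define F where "F m = restrict (poly (P m)) \<Omega>" for m
  have FP: "F m \<in> polynomials_on \<Omega>" for m by (auto simp: F_def polynomials_on_def)
  have F: "F m \<in> A_infty \<Omega>" for m
    using FP polynomials_on_subset_H_closure H_closure_subset_A_infty[OF \<Omega>] by blast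
  have fA: "f \<in> A_infty \<Omega>" unfolding f by (rule restrict_in_A_infty[OF \<Omega> U])
  have "limitin (A_infty_top \<Omega>) F f sequentially"
    unfolding limitin_A_infty_top[OF \<Omega> F fA]
  proof (intro allI impI uniform_limitI)
    fix l K and e :: real assume K: "compact K \<and> K \<subseteq> closure \<Omega>" and e: "e > 0"
    obtain m where m: "\<And>z. z \<in> K \<Longrightarrow> cmod z \<le> real m"
      using compact_imp_bounded[of K] K unfolding bounded_iff by (meson order_trans real_arch_simple)
    obtain k where k: "1 / real (Suc k) < e" using e nat_approx_posE by blast
    show "\<forall>\<^sub>F n in sequentially. \<forall>z\<in>K. dist (ext_deriv \<Omega> l (F n) z) (ext_deriv \<Omega> l f z) < e"
      using eventually_ge_at_top[of "max (max m k) l"]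
    proof eventually_elim
      case (elim n)
      show ?case
      proof
        fix z assume z: "z \<in> K"
        have "cmod z \<le> real n" using m[OF z] elim by simp
        then have zL: "z \<in> L n" "z \<in> closure \<Omega>" using K z by (auto simp: L_def)
        have "ext_deriv \<Omega> l (F n) z = (deriv ^^ l) (poly (P n)) z"
          unfolding F_def
          by (rule ext_deriv_restrict[OF \<Omega> open_UNIV])
            (use zL in \<open>auto intro: poly_holomorphic_on[OF holomorphic_on_ident]\<close>)
        moreover have "ext_deriv \<Omega> l f z = (deriv ^^ l) h z"
          unfolding f by (rule ext_deriv_restrict[OF \<Omega> U zL(2)])
        moreover have "1 / real (Suc n) \<le> 1 / real (Suc k)"
          using elim by (intro divide_left_mono) auto
        ultimately show "dist (ext_deriv \<Omega> l (F n) z) (ext_deriv \<Omega> l f z) < e"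
          using P[of l n z] zL(1) elim k by (simp add: dist_norm)
      qed
    qed
  qed
  then have ev: "\<And>V. openin (A_infty_top \<Omega>) V \<Longrightarrow> f \<in> V \<Longrightarrow> \<forall>\<^sub>F n in sequentially. F n \<in> V"
    by (simp add: limitin_def)
  show "f \<in> A_infty_top \<Omega> closure_of polynomials_on \<Omega>"
    unfolding in_closure_of topspace_A_infty_top
  proof (intro conjI fA allI impI)
    fix V assume "f \<in> V \<and> openin (A_infty_top \<Omega>) V"
    then have "\<forall>\<^sub>F n in sequentially. F n \<in> V" using ev by blast
    then obtain n where "F n \<in> V" by (auto simp: eventually_sequentially)
    then show "\<exists>y. y \<in> polynomials_on \<Omega> \<and> y \<in> V" using FP by blast
  qed
qed

lemma X_infty_eq_closure_of_polynomials:
  assumes \<Omega>: "open \<Omega>"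
    and conn: "connectedin (Alexandroff_compactification (euclidean :: complex topology))
      (UNIV - Some ` closure \<Omega>)"
  shows "X_infty \<Omega> = A_infty_top \<Omega> closure_of polynomials_on \<Omega>"
  unfolding X_infty_def
proof (rule antisym)
  show "A_infty_top \<Omega> closure_of H_closure \<Omega> \<subseteq> A_infty_top \<Omega> closure_of polynomials_on \<Omega>"
    by (intro closure_of_minimal closedin_closure_of H_closure_subset_closure_of_polynomials assms)
  show "A_infty_top \<Omega> closure_of polynomials_on \<Omega> \<subseteq> A_infty_top \<Omega> closure_of H_closure \<Omega>"
    by (rule closure_of_mono[OF polynomials_on_subset_H_closure])
qed

section \<open>The Baire category argument\<close>

text \<open>Continuity of restriction from entire functions: sup norms on large discs control all
  derivatives on smaller compact sets by Cauchy's estimate. Arguing by contradiction with a sequence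
  reduces the subbase to the description of its convergent sequences.\<close>

lemma openin_A_infty_top_entire:
  assumes \<Omega>: "open \<Omega>" and V: "openin (A_infty_top \<Omega>) V"
    and g: "g holomorphic_on UNIV" "restrict g \<Omega> \<in> V"
  shows "\<exists>R d. d > 0 \<and> (\<forall>k. k holomorphic_on UNIV \<longrightarrow> (\<forall>z\<in>cball 0 R. cmod (k z - g z) \<le> d) \<longrightarrow> restrict k \<Omega> \<in> V)"
proof (rule ccontr)
  assume neg: "\<nexists>R d. d > 0 \<and>
    (\<forall>k. k holomorphic_on UNIV \<longrightarrow> (\<forall>z\<in>cball 0 R. cmod (k z - g z) \<le> d) \<longrightarrow> restrict k \<Omega> \<in> V)"
  have "\<exists>k. k holomorphic_on UNIV \<and> (\<forall>z\<in>cball 0 (real n). cmod (k z - g z) \<le> 1 / Suc n) \<and> restrict k \<Omega> \<notin> V" for n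
  proof -
    have "1 / real (Suc n) > 0" by simp
    moreover have "\<not> (1 / real (Suc n) > 0 \<and> (\<forall>k. k holomorphic_on UNIV \<longrightarrow>
        (\<forall>z\<in>cball 0 (real n). cmod (k z - g z) \<le> 1 / real (Suc n)) \<longrightarrow> restrict k \<Omega> \<in> V))"
      by (rule contrapos_nn[OF neg], rule exI[of _ "real n"], rule exI[of _ "1 / real (Suc n)"])
    ultimately show ?thesis by blast
  qed
  then obtain k where k: "\<And>n. k n holomorphic_on UNIV"
    "\<And>n z. z \<in> cball 0 (real n) \<Longrightarrow> cmod (k n z - g z) \<le> 1 / Suc n" "\<And>n. restrict (k n) \<Omega> \<notin> V"
    by metis
  have A: "restrict h \<Omega> \<in> A_infty \<Omega>" if "h holomorphic_on UNIV" for h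
    by (rule restrict_in_A_infty[OF \<Omega> open_UNIV subset_UNIV that])
  have ext: "ext_deriv \<Omega> l (restrict h \<Omega>) z = (deriv ^^ l) h z"
    if "h holomorphic_on UNIV" "z \<in> closure \<Omega>" for h l z
    by (rule ext_deriv_restrict[OF \<Omega> open_UNIV subset_UNIV that])
  have "limitin (A_infty_top \<Omega>) (\<lambda>n. restrict (k n) \<Omega>) (restrict g \<Omega>) sequentially"
    unfolding limitin_A_infty_top[OF \<Omega> A[OF k(1)] A[OF g(1)]]
  proof (intro allI impI)
    fix l K assume K: "compact K \<and> K \<subseteq> closure \<Omega>"
    define N where "N = (\<Union>x\<in>K. cball x 1)"
    have "compact N" using K compact_minkowski_sum_cball unfolding N_def by blast
    then obtain m where m: "\<And>z. z \<in> N \<Longrightarrow> cmod z \<le> real m"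
      using compact_imp_bounded[of N] unfolding bounded_iff by (meson order_trans real_arch_simple)
    have lim: "uniform_limit N k g sequentially"
    proof (rule uniform_limitI)
      fix e :: real assume "e > 0"
      then obtain j where j: "1 / real (Suc j) < e" using nat_approx_posE by blast
      show "\<forall>\<^sub>F n in sequentially. \<forall>z\<in>N. dist (k n z) (g z) < e"
        using eventually_ge_at_top[of "max m j"]
      proof eventually_elim
        case (elim n)
        have "1 / real (Suc n) \<le> 1 / real (Suc j)" using elim by (intro divide_left_mono) auto
        then have "1 / real (Suc n) < e" using j by linarith
        moreover have "z \<in> cball 0 (real n)" if "z \<in> N" for z using m[OF that] elim by simp
        ultimately show ?case using k(2)[of _ n] by (auto simp: dist_norm intro: order.strict_trans1)
      qed
    qed
    have "uniform_limit K (\<lambda>n. (deriv ^^ l) (k n)) ((deriv ^^ l) g) sequentially"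
      by (rule uniform_limit_higher_deriv[of 1, OF _ lim[unfolded N_def]], simp, rule always_eventually, rule allI)
        (rule holomorphic_on_subset[OF k(1) subset_UNIV], rule holomorphic_on_subset[OF g(1) subset_UNIV])
    then show "uniform_limit K (\<lambda>n. ext_deriv \<Omega> l (restrict (k n) \<Omega>)) (ext_deriv \<Omega> l (restrict g \<Omega>)) sequentially"
      by (rule uniform_limit_cong'[THEN iffD1, rotated 2]) (use K ext k(1) g(1) in auto)
  qed
  then have "\<forall>\<^sub>F n in sequentially. restrict (k n) \<Omega> \<in> V" using V g(2) by (simp add: limitin_def)
  then show False using k(3) by simp
qed

lemma polynomial_in_pade_close:
  assumes \<Omega>: "open \<Omega>" and \<zeta>: "\<zeta> \<in> closure \<Omega>" and P: "P \<noteq> 0"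
  shows "restrict (poly P) \<Omega> \<in> pade_close \<Omega> \<zeta> (degree P) q j"
proof -
  let ?f = "restrict (poly P) \<Omega>"
  have hol: "poly P holomorphic_on UNIV" by (rule poly_holomorphic_on[OF holomorphic_on_ident])
  have deriv_f: "ext_deriv \<Omega> l ?f z = (deriv ^^ l) (poly P) z" if "z \<in> closure \<Omega>" for l z
    by (rule ext_deriv_restrict[OF \<Omega> open_UNIV subset_UNIV hol that])
  \<comment> \<open>The expansion of \<open>P\<close> in powers of \<open>z - \<zeta>\<close>; its
    coefficients are the Taylor coefficients, and \<open>(S, 1)\<close> is in lowest terms.\<close>
  define S where "S = pcompose P [:\<zeta>, 1:]"
  have S: "degree S = degree P" "S \<noteq> 0"
    using P by (simp_all add: S_def pcompose_eq_0_iff degree_pcompose)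
  have rat: "ratfun \<zeta> (S, 1) = poly P"
    by (rule ext) (simp add: ratfun_def S_def poly_pcompose)
  have a: "taylor_coeff \<Omega> ?f \<zeta> = coeff S"
  proof
    fix v
    have "(deriv ^^ v) (ratfun \<zeta> (S, 1)) \<zeta> / fact v = coeff S v"
      by (subst taylor_ratfun) simp_all
    then show "taylor_coeff \<Omega> ?f \<zeta> v = coeff S v"
      by (simp add: taylor_coeff_def deriv_f[OF \<zeta>] rat)
  qed
  have det: "hankel_det (taylor_coeff \<Omega> ?f \<zeta>) (degree P) q \<noteq> 0"
    unfolding a by (rule hankel_det_poly[OF S])
  have "is_pade (taylor_coeff \<Omega> ?f \<zeta>) \<zeta> (degree P) q (S, 1)"
    unfolding is_pade_iff a by (simp add: S)
  then have "pade \<Omega> ?f \<zeta> (degree P) q = (S, 1)" by (rule pade_eq[OF det])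
  then have err: "pade_error \<Omega> ?f \<zeta> (degree P) q l z = 0" if "z \<in> closure \<Omega>" for l z
    by (simp add: pade_error_def rat deriv_f[OF that])
  have "(SUP z\<in>closure \<Omega> \<inter> cball 0 (real j). pade_error \<Omega> ?f \<zeta> (degree P) q l z) \<le> 0" for l
    by (rule SUP_least) (simp add: err)
  then have "(SUP z\<in>closure \<Omega> \<inter> cball 0 (real j). pade_error \<Omega> ?f \<zeta> (degree P) q l z) < ennreal (1 / Suc j)" for l
    by (rule order.strict_trans1) simp
  moreover have "?f \<in> A_infty \<Omega>" by (rule restrict_in_A_infty[OF \<Omega> open_UNIV subset_UNIV hol])
  ultimately show ?thesis using det by (simp add: pade_close_def D_class_def)
qed

text \<open>
  Adding a small multiple of \<open>z\<^sup>p\<close> with \<open>p > degree P\<close> and \<open>(p, q) \<in> \<F>\<close> gives a polynomial of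
  degree exactly \<open>p\<close>, which is its own \<open>[p/q]\<close> approximant.
\<close>

lemma pade_close_perturbation:
  assumes \<Omega>: "open \<Omega>" and \<zeta>: "\<zeta> \<in> closure \<Omega>"
    and \<F>: "\<forall>n. (p' n, q' n) \<in> \<F>" "filterlim p' at_top sequentially" and d: "d > 0"
  shows "\<exists>P' R' d'. R' \<ge> R + 1 \<and> 0 < d' \<and> d' \<le> d / 2 \<and>
    (\<forall>z\<in>cball 0 R. cmod (poly P' z - poly P z) \<le> d / 2) \<and>
    (\<forall>k. k holomorphic_on UNIV \<longrightarrow> (\<forall>z\<in>cball 0 R'. cmod (k z - poly P' z) \<le> d') \<longrightarrow>
       restrict k \<Omega> \<in> (\<Union>(p, q)\<in>\<F>. pade_close \<Omega> \<zeta> p q j))"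
proof -
  have "\<forall>\<^sub>F n in sequentially. Suc (degree P) \<le> p' n"
    using filterlim_at_top[THEN iffD1, OF \<F>(2)] by blast
  then have "\<exists>n. Suc (degree P) \<le> p' n" by (rule eventually_happens'[OF sequentially_bot])
  then obtain n where n: "p' n > degree P" by (auto simp: Suc_le_eq)
  define p where "p = p' n"
  \<comment> \<open>Small enough that the new term is at most \<open>d / 2\<close> on the disc; the
    summand \<open>1\<close> keeps the denominator positive when \<open>R = 0\<close>.\<close>
  define c where "c = (d / 2) / (\<bar>R\<bar> ^ p + 1)"
  have c: "c > 0" "c * \<bar>R\<bar> ^ p \<le> d / 2"
  proof -
    have pos: "\<bar>R\<bar> ^ p + 1 > 0" by (simp add: add_nonneg_pos)
    show "c > 0" using d pos by (simp add: c_def)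
    have "c * \<bar>R\<bar> ^ p \<le> c * (\<bar>R\<bar> ^ p + 1)" using \<open>c > 0\<close> by (intro mult_left_mono) auto
    also have "\<dots> = d / 2"
      by (rule nonzero_eq_divide_eq[THEN iffD1, OF _ c_def]) (use pos in simp)
    finally show "c * \<bar>R\<bar> ^ p \<le> d / 2" .
  qed
  define P' where "P' = P + monom (of_real c) p"
  have deg: "degree P' = p"
    unfolding P'_def using n c(1) by (subst degree_add_eq_right) (simp_all add: degree_monom_eq p_def)
  then have "P' \<noteq> 0" using n by (auto simp: p_def)
  let ?W = "\<Union>(p, q)\<in>\<F>. pade_close \<Omega> \<zeta> p q j"
  have "restrict (poly P') \<Omega> \<in> pade_close \<Omega> \<zeta> (p' n) (q' n) j"
    using polynomial_in_pade_close[OF \<Omega> \<zeta> \<open>P' \<noteq> 0\<close>, of "q' n" j] deg by (simp add: p_def)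
  then have "restrict (poly P') \<Omega> \<in> ?W" using \<F>(1) by blast
  moreover have "openin (A_infty_top \<Omega>) ?W" using openin_pade_close[OF \<zeta>] by (intro openin_Union) auto
  moreover have "poly P' holomorphic_on UNIV" by (rule poly_holomorphic_on[OF holomorphic_on_ident])
  ultimately obtain R1 d1 where R1: "d1 > 0" "\<And>k. k holomorphic_on UNIV \<Longrightarrow>
      (\<forall>z\<in>cball 0 R1. cmod (k z - poly P' z) \<le> d1) \<Longrightarrow> restrict k \<Omega> \<in> ?W"
    using openin_A_infty_top_entire[OF \<Omega>, of ?W "poly P'"] by blast
  have "cmod (poly P' z - poly P z) \<le> d / 2" if z: "z \<in> cball 0 R" for z
  proof -
    have "cmod z \<le> \<bar>R\<bar>" using z by simp
    then have "c * cmod z ^ p \<le> c * \<bar>R\<bar> ^ p"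
      using c(1) by (intro mult_left_mono power_mono) auto
    also note c(2)
    finally have "c * cmod z ^ p \<le> d / 2" .
    moreover have "cmod (poly P' z - poly P z) = c * cmod z ^ p"
      using c(1) by (simp add: P'_def poly_monom norm_mult norm_power)
    ultimately show ?thesis by (simp only:)
  qed
  moreover have "restrict k \<Omega> \<in> ?W"
    if "k holomorphic_on UNIV" "\<forall>z\<in>cball 0 (max R1 (R + 1)). cmod (k z - poly P' z) \<le> min d1 (d / 2)" for k
    using that by (intro R1(2)) auto
  ultimately show ?thesis
    using R1(1) d
    by (intro exI[of _ P'] exI[of _ "max R1 (R + 1)"] exI[of _ "min d1 (d / 2)"]) auto
qed

text \<open>
  Baire's argument carried out with closed balls in the space of entire functions, which is complete
  and maps continuously into \<open>X_infty \<Omega>\<close>.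
\<close>

lemma entire_pade_approximable_dense:
  assumes \<Omega>: "open \<Omega>" and \<zeta>: "\<zeta> \<in> closure \<Omega>"
    and \<F>: "\<forall>n. (p' n, q' n) \<in> \<F>" "filterlim p' at_top sequentially"
    and V: "openin (A_infty_top \<Omega>) V" "restrict (poly P0) \<Omega> \<in> V"
  shows "\<exists>f. f holomorphic_on UNIV \<and> restrict f \<Omega> \<in> V \<and> pade_approximable \<Omega> \<zeta> \<F> (restrict f \<Omega>)"
proof -
  \<comment> \<open>Index 0 is reserved for the prescribed neighbourhood \<open>V\<close>, so the
    condition for \<open>j\<close> sits at index \<open>Suc j\<close>.\<close>
  define W where "W n = (case n of 0 \<Rightarrow> V | Suc j \<Rightarrow> (\<Union>(p, q)\<in>\<F>. pade_close \<Omega> \<zeta> p q j))" for n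
  define good where "good n = (\<lambda>(P, R, d). d > 0 \<and>
    (\<forall>k. k holomorphic_on UNIV \<longrightarrow> (\<forall>z\<in>cball 0 R. cmod (k z - poly P z) \<le> d) \<longrightarrow> restrict k \<Omega> \<in> W n))"
    for n :: nat
  \<comment> \<open>Moving the centre by at most \<open>d / 2\<close> and halving the radius keeps
    each ball inside the previous one. The growth of \<open>R\<close> makes the discs exhaust the
    plane.\<close>
  define step where "step = (\<lambda>(P, R, d) (P', R', d'). R' \<ge> R + 1 \<and> d' \<le> d / 2 \<and>
    (\<forall>z\<in>cball 0 R. cmod (poly P' z - poly P z) \<le> d / 2))"
    for x y :: "complex poly \<times> real \<times> real"
  have "\<exists>x. \<forall>n. good n (x n) \<and> step (x n) (x (Suc n))"
  proof (rule dependent_nat_choice)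
    have "poly P0 holomorphic_on UNIV" by (rule poly_holomorphic_on[OF holomorphic_on_ident])
    then show "\<exists>x. good 0 x"
      using openin_A_infty_top_entire[OF \<Omega> V(1) _ V(2)] unfolding good_def W_def by auto
    fix x n assume "good n x"
    obtain P R d where x: "x = (P, R, d)" by (cases x)
    have "d > 0" using \<open>good n x\<close> by (simp add: x good_def)
    show "\<exists>y. good (Suc n) y \<and> step x y"
      using pade_close_perturbation[OF \<Omega> \<zeta> \<F> \<open>d > 0\<close>, of R P n]
      unfolding good_def step_def W_def x by fastforce
  qed
  then obtain x where x: "\<And>n. good n (x n)" "\<And>n. step (x n) (x (Suc n))" by blast
  define P R d where "P n = fst (x n)" and "R n = fst (snd (x n))" and "d n = snd (snd (x n))" for n
  have xn: "x n = (P n, R n, d n)" for n by (simp add: P_def R_def d_def)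
  have d: "d n > 0" and W: "k holomorphic_on UNIV \<Longrightarrow>
      (\<forall>z\<in>cball 0 (R n). cmod (k z - poly (P n) z) \<le> d n) \<Longrightarrow> restrict k \<Omega> \<in> W n" for n k
    using x(1)[of n] by (auto simp: xn good_def)
  have Rd: "R (Suc n) \<ge> R n + 1" "d (Suc n) \<le> d n / 2"
    and Pstep: "z \<in> cball 0 (R n) \<Longrightarrow> cmod (poly (P (Suc n)) z - poly (P n) z) \<le> d n / 2" for n z
    using x(2)[of n] by (auto simp: xn step_def)
  have R_mono: "R (n + k) \<ge> R n + real k" for n k
  proof (induction k)
    case (Suc k)
    then show ?case using Rd(1)[of "n + k"] by simp
  qed simp
  have d_le: "d n \<le> d 0 / 2 ^ n" for n
  proof (induction n)
    case (Suc n)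
    then show ?case using Rd(2)[of n] by simp
  qed simp
  \<comment> \<open>The bound \<open>d n - d (n + k)\<close> telescopes, because
    \<open>d m / 2 \<le> d m - d (Suc m)\<close>; a bound by \<open>d n\<close> alone would not
    survive the induction.\<close>
  have close: "cmod (poly (P (n + k)) z - poly (P n) z) \<le> d n - d (n + k)" if z: "z \<in> cball 0 (R n)" for n k z
  proof (induction k)
    case (Suc k)
    have "z \<in> cball 0 (R (n + k))" using z R_mono[of n k] by simp
    then have "cmod (poly (P (Suc (n + k))) z - poly (P (n + k)) z) \<le> d (n + k) / 2" by (rule Pstep)
    moreover have "cmod (poly (P (Suc (n + k))) z - poly (P n) z)
        \<le> cmod (poly (P (Suc (n + k))) z - poly (P (n + k)) z) + cmod (poly (P (n + k)) z - poly (P n) z)"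
      using norm_triangle_ineq[of "poly (P (Suc (n + k))) z - poly (P (n + k)) z"
          "poly (P (n + k)) z - poly (P n) z"] by simp
    ultimately show ?case using Suc Rd(2)[of "n + k"] by simp
  qed simp
  have d_lim: "d \<longlonglongrightarrow> 0"
  proof (rule tendsto_sandwich[OF _ _ tendsto_const])
    show "\<forall>\<^sub>F n in sequentially. 0 \<le> d n" using d by (simp add: less_imp_le)
    show "\<forall>\<^sub>F n in sequentially. d n \<le> d 0 * (1 / 2) ^ n" using d_le by (simp add: power_one_over)
    show "(\<lambda>n. d 0 * (1 / 2) ^ n) \<longlonglongrightarrow> 0" by (intro tendsto_mult_right_zero LIMSEQ_power_zero) simp
  qed
  have big: "\<exists>n. z \<in> cball 0 (R n)" for z :: complex
  proof -
    obtain n where "cmod z - R 0 \<le> real n" using real_arch_simple by blast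
    then show ?thesis using R_mono[of 0 n] by (intro exI[of _ n]) simp
  qed
  have "convergent (\<lambda>m. poly (P m) z)" for z
  proof -
    obtain n0 where n0: "z \<in> cball 0 (R n0)" using big by blast
    have "Cauchy (\<lambda>m. poly (P m) z)"
    proof (rule metric_CauchyI)
      fix e :: real assume "e > 0"
      then have "\<forall>\<^sub>F n in sequentially. d n < e / 2" using d_lim by (intro order_tendstoD(2)) auto
      then obtain n1 where n1: "\<And>n. n \<ge> n1 \<Longrightarrow> d n < e / 2" by (auto simp: eventually_sequentially)
      define N where "N = max n0 n1"
      have zN: "z \<in> cball 0 (R N)"
        using n0 R_mono[of n0 "N - n0"] by (simp add: N_def)
      have near: "cmod (poly (P m) z - poly (P N) z) < e / 2" if "m \<ge> N" for m
        using close[OF zN, of "m - N"] that d[of m] n1[of N] by (simp add: N_def)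
      show "\<exists>M. \<forall>m\<ge>M. \<forall>n\<ge>M. dist (poly (P m) z) (poly (P n) z) < e"
        using near norm_diff_triangle_less[of _ "poly (P N) z" "e / 2" _ "e / 2"]
        by (intro exI[of _ N]) (auto simp: dist_norm norm_minus_commute)
    qed
    then show ?thesis by (rule Cauchy_convergent)
  qed
  then obtain f where f: "\<And>z. (\<lambda>m. poly (P m) z) \<longlonglongrightarrow> f z"
    unfolding convergent_def by metis
  \<comment> \<open>The limit lies in every ball because the balls are closed: non-strict bounds
    survive the limit.\<close>
  have fP: "cmod (f z - poly (P n) z) \<le> d n" if z: "z \<in> cball 0 (R n)" for n z
  proof (rule Lim_bounded)
    show "(\<lambda>m. cmod (poly (P m) z - poly (P n) z)) \<longlonglongrightarrow> cmod (f z - poly (P n) z)"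
      by (intro tendsto_norm tendsto_diff f tendsto_const)
    show "\<forall>m\<ge>n. cmod (poly (P m) z - poly (P n) z) \<le> d n"
    proof (intro allI impI)
      fix m assume "n \<le> m"
      then show "cmod (poly (P m) z - poly (P n) z) \<le> d n"
        using close[OF z, of "m - n"] d[of m] by simp
    qed
  qed
  have fhol: "f holomorphic_on UNIV"
  proof (rule holomorphic_uniform_sequence[OF open_UNIV])
    show "poly (P n) holomorphic_on UNIV" for n by (rule poly_holomorphic_on[OF holomorphic_on_ident])
    fix z :: complex
    obtain n0 where n0: "cmod z + 1 \<le> R n0"
    proof -
      obtain n where "of_real (cmod z + 1) \<in> cball (0::complex) (R n)" using big by blast
      then show ?thesis using that[of n] by (simp del: of_real_add)
    qed
    have "uniform_limit (cball z 1) (\<lambda>n. poly (P n)) f sequentially"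
    proof (rule uniform_limitI)
      fix e :: real assume "e > 0"
      then have "\<forall>\<^sub>F n in sequentially. d n < e" using d_lim by (intro order_tendstoD(2)) auto
      then show "\<forall>\<^sub>F n in sequentially. \<forall>w\<in>cball z 1. dist (poly (P n) w) (f w) < e"
        using eventually_ge_at_top[of n0]
      proof eventually_elim
        case (elim n)
        show ?case
        proof
          fix w assume "w \<in> cball z 1"
          then have "cmod w \<le> cmod z + 1"
            using norm_triangle_sub[of w z] by (simp add: dist_norm norm_minus_commute)
          then have "w \<in> cball 0 (R n)" using n0 R_mono[of n0 "n - n0"] elim by simp
          then show "dist (poly (P n) w) (f w) < e"
            using fP[of w n] elim by (simp add: dist_norm norm_minus_commute)
        qed
      qed
    qed
    then show "\<exists>d>0. cball z d \<subseteq> UNIV \<and> uniform_limit (cball z d) (\<lambda>n. poly (P n)) f sequentially"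
      by (intro exI[of _ 1]) simp
  qed
  have fW: "restrict f \<Omega> \<in> W n" for n using W[OF fhol] fP by blast
  have "restrict f \<Omega> \<in> V" using fW[of 0] by (simp add: W_def)
  moreover have "pade_approximable \<Omega> \<zeta> \<F> (restrict f \<Omega>)"
    unfolding pade_approximable_iff
  proof
    fix j
    show "\<exists>(p, q)\<in>\<F>. restrict f \<Omega> \<in> pade_close \<Omega> \<zeta> p q j" using fW[of "Suc j"] by (auto simp: W_def)
  qed
  ultimately show ?thesis using fhol by blast
qed

theorem theorem4p6:
  fixes \<Omega> :: "complex set" and \<zeta>\<^sub>0 :: complex and \<F> :: "(nat \<times> nat) set"
    and p' q' :: "nat \<Rightarrow> nat"
  assumes "open \<Omega>"
    and "connectedin (Alexandroff_compactification (euclidean :: complex topology))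
           (UNIV - Some ` closure \<Omega>)"
    and "\<zeta>\<^sub>0 \<in> closure \<Omega>"
    and "\<forall>n. (p' n, q' n) \<in> \<F>"
    and "filterlim p' at_top sequentially"
  shows "(\<exists>f \<in> A_infty \<Omega>. pade_approximable \<Omega> \<zeta>\<^sub>0 \<F> f)
    \<and> gdelta_in (subtopology (A_infty_top \<Omega>) (X_infty \<Omega>))
        {f \<in> X_infty \<Omega>. pade_approximable \<Omega> \<zeta>\<^sub>0 \<F> f}
    \<and> subtopology (A_infty_top \<Omega>) (X_infty \<Omega>) closure_of
        {f \<in> X_infty \<Omega>. pade_approximable \<Omega> \<zeta>\<^sub>0 \<F> f} = X_infty \<Omega>
    \<and> X_infty \<Omega> = A_infty_top \<Omega> closure_of polynomials_on \<Omega>"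
proof -
  let ?T = "A_infty_top \<Omega>"
  define E where "E = {f \<in> X_infty \<Omega>. pade_approximable \<Omega> \<zeta>\<^sub>0 \<F> f}"
  note X = X_infty_eq_closure_of_polynomials[OF assms(1,2)]
  have X_sub: "X_infty \<Omega> \<subseteq> A_infty \<Omega>"
    unfolding X_infty_def using closure_of_subset_topspace[of ?T "H_closure \<Omega>"]
    by (simp add: topspace_A_infty_top)
  have H_sub: "H_closure \<Omega> \<subseteq> X_infty \<Omega>"
    unfolding X_infty_def using H_closure_subset_A_infty[OF assms(1)]
    by (intro closure_of_subset) (simp add: topspace_A_infty_top)
  \<comment> \<open>Polynomials are dense in \<open>X_infty \<Omega>\<close>, so it is enough to
    reach them by members of \<open>E\<close>; the functions found are entire and hence lie in
    \<open>X_infty \<Omega>\<close>.\<close>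
  have pol: "polynomials_on \<Omega> \<subseteq> ?T closure_of E"
  proof
    fix f assume "f \<in> polynomials_on \<Omega>"
    then obtain P where f: "f = restrict (poly P) \<Omega>" by (auto simp: polynomials_on_def)
    show "f \<in> ?T closure_of E"
      unfolding in_closure_of topspace_A_infty_top
    proof (intro conjI allI impI)
      show "f \<in> A_infty \<Omega>"
        using \<open>f \<in> polynomials_on \<Omega>\<close> polynomials_on_subset_H_closure H_sub X_sub by blast
      fix V assume "f \<in> V \<and> openin ?T V"
      then obtain g where "g holomorphic_on UNIV" "restrict g \<Omega> \<in> V" "pade_approximable \<Omega> \<zeta>\<^sub>0 \<F> (restrict g \<Omega>)"
        using entire_pade_approximable_dense[OF assms(1,3,4,5), of V P] f by blast
      then show "\<exists>y. y \<in> E \<and> y \<in> V" using entire_in_H_closure H_sub unfolding E_def by blast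
    qed
  qed
  then have "X_infty \<Omega> \<subseteq> ?T closure_of E"
    unfolding X by (intro closure_of_minimal closedin_closure_of)
  then have dense: "subtopology ?T (X_infty \<Omega>) closure_of E = X_infty \<Omega>"
    unfolding closure_of_subtopology by (simp add: E_def Int_absorb1 Int_absorb2 Collect_mono)
  have gdelta: "gdelta_in (subtopology ?T (X_infty \<Omega>)) E"
  proof -
    define G where "G j = X_infty \<Omega> \<inter> (\<Union>(p, q)\<in>\<F>. pade_close \<Omega> \<zeta>\<^sub>0 p q j)" for j
    have E: "E = \<Inter> (range G)"
      unfolding E_def G_def pade_approximable_iff by auto
    have op: "openin (subtopology ?T (X_infty \<Omega>)) (G j)" for j
    proof -
      have "openin ?T (\<Union>(p, q)\<in>\<F>. pade_close \<Omega> \<zeta>\<^sub>0 p q j)"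
        using openin_pade_close[OF assms(3)] by (intro openin_Union) auto
      then show ?thesis unfolding G_def by (auto simp: openin_subtopology)
    qed
    show ?thesis
      unfolding E by (rule gdelta_in_Inter) (use op in \<open>auto intro!: open_imp_gdelta_in\<close>)
  qed
  have "\<exists>f\<in>A_infty \<Omega>. pade_approximable \<Omega> \<zeta>\<^sub>0 \<F> f"
  proof -
    \<comment> \<open>A witness that \<open>X_infty \<Omega>\<close> is nonempty, so that its dense
      subset \<open>E\<close> is nonempty too.\<close>
    have "restrict (poly 0) \<Omega> \<in> X_infty \<Omega>"
      using polynomials_on_subset_H_closure H_sub by (auto simp: polynomials_on_def)
    then have "E \<noteq> {}" using dense by auto
    then show ?thesis using X_sub by (auto simp: E_def)
  qed
  then show ?thesis using gdelta dense X unfolding E_def by blast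
qed

end
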